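(* Let $A$ be a ring with $1$ of finite (i.e. positive) characteristic whose group of units $A^*$ is finite and abelian. Then $A^*$ is isomorphic to a finite product of groups of the form $\mathbb F_{p^\lambda}^*\times H$, where in each factor $p$ is a prime dividing $\mathrm{char}(A)$, $\lambda\ge 1$, and $H=1+\mathfrak m$ is the abelian $p$-group attached to some finite commutative local ring $(B,\mathfrak m)$ of characteristic a power of $p$ with $B/\mathfrak m\cong\mathbb F_{p^\lambda}$; and each prime $p\mid\mathrm{char}(A)$ gives at least one factor. Moreover, the finite abelian groups that occur (up to isomorphism) as groups of units of reduced rings of finite characteristic are exactly the finite products of multiplicative groups of finite fields. Finally, if $A$ is a domain, then $A^*$ is isomorphic to the multiplicative group of a finite field.
   Context: $A^*$ denotes the group of units of a ring $A$. A ring is called reduced if it has no non-zero nilpotent elements. $\mathbb F_q$ denotes the finite field with $q$ elements. *)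

theory Defs
  imports "HOL-Algebra.Algebra" "HOL-Computational_Algebra.Primes"
begin

definition ring_char :: "('a, 'm) ring_scheme \<Rightarrow> nat" where
  "ring_char R =
    (if \<exists>n::nat. 0 < n \<and> add_pow R n \<one>\<^bsub>R\<^esub> = \<zero>\<^bsub>R\<^esub>
     then (LEAST n::nat. 0 < n \<and> add_pow R n \<one>\<^bsub>R\<^esub> = \<zero>\<^bsub>R\<^esub>) else 0)"

text \<open>In \<open>reduced_ring\<close> and \<open>ring_without_zero_divisors\<close> multiplication need not be commutative;
  the library's locale \<^locale>\<open>domain\<close> is the commutative case of the latter.\<close>

definition reduced_ring :: "('a, 'm) ring_scheme \<Rightarrow> bool" where
  "reduced_ring R \<longleftrightarrow> ring R \<and>
    (\<forall>x\<in>carrier R. \<forall>n::nat. 0 < n \<longrightarrow> x [^]\<^bsub>R\<^esub> n = \<zero>\<^bsub>R\<^esub> \<longrightarrow> x = \<zero>\<^bsub>R\<^esub>)"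

definition ring_without_zero_divisors :: "('a, 'm) ring_scheme \<Rightarrow> bool" where
  "ring_without_zero_divisors R \<longleftrightarrow> ring R \<and> \<one>\<^bsub>R\<^esub> \<noteq> \<zero>\<^bsub>R\<^esub> \<and>
    (\<forall>a\<in>carrier R. \<forall>b\<in>carrier R. a \<otimes>\<^bsub>R\<^esub> b = \<zero>\<^bsub>R\<^esub> \<longrightarrow> a = \<zero>\<^bsub>R\<^esub> \<or> b = \<zero>\<^bsub>R\<^esub>)"

lemma domain_iff_cring_without_zero_divisors:
  "domain R \<longleftrightarrow> cring R \<and> ring_without_zero_divisors R"
  by (auto simp: domain_def domain_axioms_def ring_without_zero_divisors_def cring_def)

definition local_ring :: "('a, 'm) ring_scheme \<Rightarrow> 'a set \<Rightarrow> bool" where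
  "local_ring B \<mm> \<longleftrightarrow> cring B \<and> maximalideal \<mm> B \<and> (\<forall>J. maximalideal J B \<longrightarrow> J = \<mm>)"

definition one_plus_group :: "('a, 'm) ring_scheme \<Rightarrow> 'a set \<Rightarrow> 'a monoid" where
  "one_plus_group B \<mm> = (units_of B)\<lparr>carrier := \<one>\<^bsub>B\<^esub> <+\<^bsub>B\<^esub> \<mm>\<rparr>"

text \<open>Finite rings and fields are quantified over carriers in \<open>nat\<close>, which loses
  no generality: every finite ring is isomorphic to one of these.\<close>

definition product_of_finite_field_unit_groups :: "('g, 'm) monoid_scheme \<Rightarrow> bool" where
  "product_of_finite_field_unit_groups G \<longleftrightarrow>
    (\<exists>(n::nat) (K :: nat \<Rightarrow> nat ring).
      (\<forall>i<n. field (K i) \<and> finite (carrier (K i))) \<and>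
      G \<cong> product_group {..<n} (\<lambda>i. units_of (K i)))"

text \<open>The type argument fixes where the elements of the ring live, as HOL cannot
  quantify existentially over types.\<close>

definition occurs_as_units_of_reduced_ring ::
    "'a itself \<Rightarrow> ('g, 'm) monoid_scheme \<Rightarrow> bool" where
  "occurs_as_units_of_reduced_ring (_ :: 'a itself) G \<longleftrightarrow>
    (\<exists>R :: 'a ring. reduced_ring R \<and> 0 < ring_char R \<and> G \<cong> units_of R)"

end

theory Submission
  imports Defs
begin

text \<open>
  Let \<open>A\<close> have positive characteristic and finite abelian unit group.  The additive span of the
  units is closed under multiplication, commutative, and finite, since it is a finitely generated
  abelian group of finite exponent (\<open>finite_unit_span\<close>, \<open>cring_unit_span\<close>).  It has the same units
  and the same characteristic as \<open>A\<close>, and it inherits reducedness and the absence of zero divisors.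
  So all three assertions reduce to finite commutative rings.

  In a finite commutative ring \<open>R\<close> the primitive idempotents are orthogonal with sum \<open>\<one>\<close>, so
  \<open>R\<^sup>*\<close> is the product of the unit groups of the corners \<open>e R\<close>
  (\<open>units_of_iso_product_corners\<close>).  Some power of any element of a finite ring is idempotent, and
  the only idempotents of a corner \<open>e R\<close> with \<open>e\<close> primitive are \<open>\<zero>\<close> and \<open>e\<close>; hence each of its
  elements is a unit or nilpotent.  If \<open>R\<close> is reduced, the corners are therefore fields.  In
  general the non-units of such a ring \<open>B\<close> form its only maximal ideal \<open>\<mm>\<close>, and the
  characteristic and the order of \<open>B\<close> are powers of one prime \<open>p\<close>.  The reduction from \<open>B\<^sup>*\<close> to
  the units of \<open>B/\<mm>\<close> has kernel \<open>1 + \<mm>\<close>, a \<open>p\<close>-group, and image of order \<open>p ^ l - 1\<close>; as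
  these orders are coprime, \<open>B\<^sup>*\<close> is the direct product of the two
  (\<open>coprime_extension_splits\<close>, \<open>finite_local_units\<close>).

  Conversely, a finite product of finite fields is a reduced ring whose unit group is the product of
  the multiplicative groups (\<open>product_of_field_units_occurs\<close>).
\<close>

section \<open>The characteristic\<close>

lemma (in ring) ring_char_eq_ord: "ring_char R = add.ord \<one>"
proof -
  have *: "add_pow R n \<one> = \<zero> \<longleftrightarrow> add.ord \<one> dvd n" for n :: nat
    using add.pow_eq_id[of \<one> n] by simp
  show ?thesis
  proof (cases "add.ord \<one> = 0")
    case True
    then show ?thesis
      by (simp add: ring_char_def *)
  next
    case False
    then have "(LEAST n::nat. 0 < n \<and> add.ord \<one> dvd n) = add.ord \<one>"
      by (intro Least_equality) (auto dest: dvd_imp_le)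
    with False show ?thesis
      by (auto simp add: ring_char_def *)
  qed
qed

lemma (in ring) add_pow_one_eq_zero_iff:
  "add_pow R (n::nat) \<one> = \<zero> \<longleftrightarrow> ring_char R dvd n"
  unfolding ring_char_eq_ord using add.pow_eq_id[of \<one> n] by simp

lemma (in ring) add_pow_eq_mult_one:
  assumes "x \<in> carrier R"
  shows "add_pow R (n::nat) x = add_pow R n \<one> \<otimes> x"
  using assms by (simp add: add_pow_ldistr)

lemma (in ring) add_pow_ring_char:
  assumes "x \<in> carrier R" "ring_char R dvd n"
  shows "add_pow R (n::nat) x = \<zero>"
  using assms add_pow_one_eq_zero_iff[of n] by (simp add: add_pow_eq_mult_one[of x])

lemma (in ring) ring_char_pos:
  assumes "finite (carrier R)"
  shows "0 < ring_char R"
proof -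
  have "add_pow R (order (add_monoid R)) \<one> = \<zero>"
    using add.pow_order_eq_1[of \<one>] by simp
  moreover have "0 < order (add_monoid R)"
    using assms add.order_gt_0_iff_finite by simp
  ultimately show ?thesis
    using add_pow_one_eq_zero_iff[of "order (add_monoid R)"] by (auto intro: Nat.gr0I)
qed

section \<open>The subring spanned by the units\<close>

lemma (in monoid) nat_pow_mod:
  assumes "x \<in> carrier G" "x [^] (m::nat) = \<one>"
  shows "x [^] (k mod m) = x [^] k"
proof -
  have "x [^] k = x [^] (m * (k div m) + k mod m)"
    by simp
  also have "\<dots> = (x [^] m) [^] (k div m) \<otimes> x [^] (k mod m)"
    using assms(1) by (simp only: nat_pow_mult[symmetric] nat_pow_pow)
  finally show ?thesis
    using assms by simp
qed

text \<open>The subgroup generated by \<open>U\<close> and a further element \<open>u\<close> consists of the products of an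
  element of the subgroup generated by \<open>U\<close> with one of finitely many powers of \<open>u\<close>.\<close>

lemma (in comm_group) finite_generate:
  assumes "finite U" "U \<subseteq> carrier G" "0 < c" "\<And>u. u \<in> U \<Longrightarrow> u [^] (c::nat) = \<one>"
  shows "finite (generate G U)"
  using assms
proof (induction U rule: finite_induct)
  case empty
  then show ?case
    by (simp add: generate_empty)
next
  case (insert u U)
  have u: "u \<in> carrier G" and U: "U \<subseteq> carrier G" and ord: "u [^] c = \<one>"
    using insert.prems by auto
  have fin: "finite (generate G U)"
    using insert by auto
  let ?S = "(\<lambda>(k::nat, h). u [^] k \<otimes> h) ` ({..<c} \<times> generate G U)"
  have gen: "subgroup (generate G U) G"
    using U by (rule generate_is_subgroup)
  have red: "u [^] k = u [^] (k mod c)" for k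
    using nat_pow_mod[OF u ord] by simp
  have in_S: "u [^] k \<otimes> h \<in> ?S" if "h \<in> generate G U" for k :: nat and h
    using that red[of k] \<open>0 < c\<close> by (auto intro!: image_eqI[where x = "(k mod c, h)"])
  have "subgroup ?S G"
  proof (rule subgroupI)
    show "?S \<subseteq> carrier G"
      using u subgroup.mem_carrier[OF gen] by auto
    show "?S \<noteq> {}"
      using \<open>0 < c\<close> subgroup.one_closed[OF gen] by auto
  next
    fix x assume "x \<in> ?S"
    then obtain k h where x: "k < c" "h \<in> generate G U" "x = u [^] k \<otimes> h"
      by auto
    have "inv (u [^] k) = u [^] (c - k)"
      using x u ord by (intro inv_equality) (simp_all add: nat_pow_mult)
    then have "inv x = u [^] (c - k) \<otimes> inv h"
      using x u subgroup.mem_carrier[OF gen] by (simp add: inv_mult)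
    then show "inv x \<in> ?S"
      using in_S[of "inv h"] x subgroup.m_inv_closed[OF gen] by auto
  next
    fix x y assume "x \<in> ?S" "y \<in> ?S"
    then obtain k h where x: "k < c" "h \<in> generate G U" "x = u [^] k \<otimes> h"
      by auto
    from \<open>y \<in> ?S\<close> obtain j g where y: "j < c" "g \<in> generate G U" "y = u [^] j \<otimes> g"
      by auto
    have "x \<otimes> y = u [^] (k + j) \<otimes> (h \<otimes> g)"
      using x y u subgroup.mem_carrier[OF gen]
      by (simp add: nat_pow_mult[symmetric] m_ac)
    then show "x \<otimes> y \<in> ?S"
      using in_S[of "h \<otimes> g"] x y subgroup.m_closed[OF gen] by auto
  qed
  moreover have "insert u U \<subseteq> ?S"
  proof
    fix x assume "x \<in> insert u U"
    then show "x \<in> ?S"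
      using in_S[OF subgroup.one_closed[OF gen], of 1] in_S[of x 0] u U
      by (cases "x = u") (simp_all add: generate.incl subset_eq)
  qed
  ultimately have "generate G (insert u U) \<subseteq> ?S"
    by (intro generate_subgroup_incl)
  then show ?case
    by (rule finite_subset) (use fin in auto)
qed

text \<open>The additive subgroup generated by the units, with the operations of the ring.  As products
  of units are units, it is the subring generated by the units.\<close>

definition unit_span :: "('a, 'm) ring_scheme \<Rightarrow> ('a, 'm) ring_scheme" where
  "unit_span R = R\<lparr>carrier := generate (add_monoid R) (Units R)\<rparr>"

lemma unit_span_simps [simp]:
  "\<zero>\<^bsub>unit_span R\<^esub> = \<zero>\<^bsub>R\<^esub>" "\<one>\<^bsub>unit_span R\<^esub> = \<one>\<^bsub>R\<^esub>"
  "(\<oplus>\<^bsub>unit_span R\<^esub>) = (\<oplus>\<^bsub>R\<^esub>)" "(\<otimes>\<^bsub>unit_span R\<^esub>) = (\<otimes>\<^bsub>R\<^esub>)"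
  "([^]\<^bsub>unit_span R\<^esub>) = (([^]\<^bsub>R\<^esub>) :: _ \<Rightarrow> nat \<Rightarrow> _)"
  "ring_char (unit_span R) = ring_char R"
  by (simp_all add: unit_span_def nat_pow_def fun_eq_iff ring_char_def add_pow_def cong: if_cong)

context ring
begin

lemma generate_induct [consumes 2, case_names zero incl minus add]:
  assumes "x \<in> generate (add_monoid R) U" "U \<subseteq> carrier R"
    and "P \<zero>" "\<And>u. u \<in> U \<Longrightarrow> P u"
    and "\<And>x. x \<in> carrier R \<Longrightarrow> P x \<Longrightarrow> P (\<ominus> x)"
    and "\<And>x y. x \<in> carrier R \<Longrightarrow> y \<in> carrier R \<Longrightarrow> P x \<Longrightarrow> P y \<Longrightarrow> P (x \<oplus> y)"
  shows "P x"
proof -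
  have "generate (add_monoid R) U \<subseteq> {x \<in> carrier R. P x}"
  proof (rule add.generate_subgroup_incl)
    show "U \<subseteq> {x \<in> carrier R. P x}"
      using assms by auto
    show "subgroup {x \<in> carrier R. P x} (add_monoid R)"
      by (rule add.subgroupI) (use assms in auto)
  qed
  then show ?thesis
    using assms(1) by auto
qed

lemma unit_span_subset: "carrier (unit_span R) \<subseteq> carrier R"
  using add.generate_incl[of "Units R"] by (auto simp: unit_span_def)

lemma subring_unit_span: "subring (carrier (unit_span R)) R"
proof -
  have U: "Units R \<subseteq> carrier R"
    by auto
  let ?S = "generate (add_monoid R) (Units R)"
  have sub: "subgroup ?S (add_monoid R)"
    using add.generate_is_subgroup[of "Units R"] by auto
  have car: "?S \<subseteq> carrier R"
    using add.generate_incl[of "Units R"] by auto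
  have add_closed: "x \<oplus> y \<in> ?S" if "x \<in> ?S" "y \<in> ?S" for x y
    using subgroup.m_closed[OF sub that] by simp
  have minus_closed: "\<ominus> x \<in> ?S" if "x \<in> ?S" for x
    using subgroup.m_inv_closed[OF sub that] by (simp add: a_inv_def)
  have zero_closed: "\<zero> \<in> ?S"
    using subgroup.one_closed[OF sub] by simp
  have unit_mult: "u \<otimes> x \<in> ?S" if "u \<in> Units R" "x \<in> ?S" for u x
    using that(2) U
  proof (induction rule: generate_induct)
    case (minus x)
    then show ?case
      using that minus_closed[of "u \<otimes> x"] by (simp add: r_minus Units_closed)
  next
    case (add x y)
    then show ?case
      using that add_closed by (simp add: r_distr Units_closed)
  qed (use that zero_closed in \<open>auto intro: generate.incl simp: Units_closed\<close>)
  have mult: "x \<otimes> y \<in> ?S" if "y \<in> ?S" "x \<in> ?S" for x y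
    using that(2) U
  proof (induction rule: generate_induct)
    case zero
    then show ?case
      using that car zero_closed by (simp add: subsetD)
  next
    case (incl u)
    then show ?case
      using that unit_mult by simp
  next
    case (minus x)
    moreover have "y \<in> carrier R"
      using that car by auto
    ultimately show ?case
      using minus_closed[of "x \<otimes> y"] by (simp add: l_minus)
  next
    case (add x x')
    moreover have "y \<in> carrier R"
      using that car by auto
    ultimately show ?case
      using add_closed by (simp add: l_distr)
  qed
  show ?thesis
    unfolding unit_span_def
    using car mult add_closed minus_closed by (intro subringI) (auto intro: generate.incl)
qed

lemma Units_unit_span: "Units (unit_span R) = Units R"
proof
  show "Units (unit_span R) \<subseteq> Units R"
    using unit_span_subset unfolding Units_def by auto
  show "Units R \<subseteq> Units (unit_span R)"
  proof
    fix u assume u: "u \<in> Units R"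
    have "inv u \<in> Units R"
      using u by simp
    then have "u \<in> carrier (unit_span R)" "inv u \<in> carrier (unit_span R)"
      using u by (auto simp: unit_span_def intro: generate.incl)
    moreover have "inv u \<otimes> u = \<one>" "u \<otimes> inv u = \<one>"
      using u by simp_all
    ultimately show "u \<in> Units (unit_span R)"
      unfolding Units_def by auto
  qed
qed

lemma units_of_unit_span: "units_of (unit_span R) = units_of R"
  by (simp add: units_of_def Units_unit_span)

lemma cring_unit_span:
  assumes "comm_group (units_of R)"
  shows "cring (unit_span R)"
proof -
  have U: "Units R \<subseteq> carrier R"
    by auto
  let ?S = "generate (add_monoid R) (Units R)"
  have car: "?S \<subseteq> carrier R"
    using add.generate_incl[of "Units R"] by auto
  have comm_units: "u \<otimes> v = v \<otimes> u" if "u \<in> Units R" "v \<in> Units R" for u v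
    using comm_monoid.m_comm[OF comm_group.axioms(1)[OF assms], of u v] that
    by (simp add: units_of_def)
  have comm_unit: "u \<otimes> x = x \<otimes> u" if "u \<in> Units R" "x \<in> ?S" for u x
    using that(2) U
  proof (induction rule: generate_induct)
  qed (use that comm_units in \<open>auto simp: Units_closed r_minus l_minus r_distr l_distr\<close>)
  have comm: "x \<otimes> y = y \<otimes> x" if "y \<in> ?S" "x \<in> ?S" for x y
  proof -
    have y: "y \<in> carrier R"
      using that car by auto
    show ?thesis
      using that(2) U
    proof (induction rule: generate_induct)
    qed (use that comm_unit y in \<open>auto simp: Units_closed r_minus l_minus r_distr l_distr\<close>)
  qed
  have "subcring ?S R"
    by (rule subcringI) (use subring_unit_span comm in \<open>auto simp: unit_span_def\<close>)
  then show ?thesis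
    using subcring_iff[OF car] by (simp add: unit_span_def)
qed

lemma finite_unit_span:
  assumes "finite (Units R)" "0 < ring_char R"
  shows "finite (carrier (unit_span R))"
proof -
  have "add_pow R (ring_char R) u = \<zero>" if "u \<in> Units R" for u
    using that by (simp add: add_pow_ring_char Units_closed)
  then have "finite (generate (add_monoid R) (Units R))"
    using assms by (intro add.finite_generate) (auto simp: Units_closed)
  then show ?thesis
    by (simp add: unit_span_def)
qed

end

section \<open>Products of groups\<close>

lemma product_group_cong_iso:
  assumes "\<And>i. i \<in> I \<Longrightarrow> G i \<cong> H i"
  shows "product_group I G \<cong> product_group I H"
proof -
  have "\<forall>i\<in>I. \<exists>f. f \<in> iso (G i) (H i)"
    using assms unfolding is_iso_def by blast
  then obtain f where f: "\<And>i. i \<in> I \<Longrightarrow> f i \<in> iso (G i) (H i)"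
    by metis
  have bij: "bij_betw (f i) (carrier (G i)) (carrier (H i))" if "i \<in> I" for i
    using f[OF that] by (simp add: iso_def)
  let ?F = "\<lambda>x. \<lambda>i\<in>I. f i (x i)"
  have closed: "f i a \<in> carrier (H i)" if "i \<in> I" "a \<in> carrier (G i)" for i a
    using bij[OF that(1)] that(2) by (auto simp: bij_betw_def)
  have F_closed: "?F x \<in> (\<Pi>\<^sub>E i\<in>I. carrier (H i))" if "x \<in> (\<Pi>\<^sub>E i\<in>I. carrier (G i))" for x
    using closed PiE_mem[OF that] by simp
  have inj: "inj_on ?F (\<Pi>\<^sub>E i\<in>I. carrier (G i))"
  proof (rule inj_onI)
    fix x y assume x: "x \<in> (\<Pi>\<^sub>E i\<in>I. carrier (G i))" and y: "y \<in> (\<Pi>\<^sub>E i\<in>I. carrier (G i))"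
      and eq: "?F x = ?F y"
    show "x = y"
    proof (rule PiE_ext[OF x y])
      fix i assume i: "i \<in> I"
      then show "x i = y i"
        using fun_cong[OF eq, of i] bij[OF i] PiE_mem[OF x i] PiE_mem[OF y i]
        by (auto simp: bij_betw_def dest: inj_onD)
    qed
  qed
  have surj: "y \<in> ?F ` (\<Pi>\<^sub>E i\<in>I. carrier (G i))" if y: "y \<in> (\<Pi>\<^sub>E i\<in>I. carrier (H i))" for y
  proof
    let ?x = "\<lambda>i\<in>I. inv_into (carrier (G i)) (f i) (y i)"
    have img: "y i \<in> f i ` carrier (G i)" if "i \<in> I" for i
      using bij[OF that] PiE_mem[OF y that] by (simp add: bij_betw_def)
    then show "?x \<in> (\<Pi>\<^sub>E i\<in>I. carrier (G i))"
      by (simp add: inv_into_into)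
    show "y = ?F ?x"
    proof
      fix i
      show "y i = ?F ?x i"
        using img[of i] PiE_arb[OF y, of i] by (cases "i \<in> I") (simp_all add: f_inv_into_f)
    qed
  qed
  have "f i (x i \<otimes>\<^bsub>G i\<^esub> y i) = f i (x i) \<otimes>\<^bsub>H i\<^esub> f i (y i)"
    if "x \<in> (\<Pi>\<^sub>E i\<in>I. carrier (G i))" "y \<in> (\<Pi>\<^sub>E i\<in>I. carrier (G i))" "i \<in> I" for x y i
    using f[OF that(3)] PiE_mem[OF that(1,3)] PiE_mem[OF that(2,3)]
    by (simp add: iso_def hom_mult)
  then have "?F \<in> hom (product_group I G) (product_group I H)"
    using F_closed by (intro homI) (simp_all add: PiE_mem cong: restrict_cong)
  moreover have "?F ` (\<Pi>\<^sub>E i\<in>I. carrier (G i)) = (\<Pi>\<^sub>E i\<in>I. carrier (H i))"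
    using F_closed surj by blast
  ultimately have "?F \<in> iso (product_group I G) (product_group I H)"
    using inj by (simp add: iso_def bij_betw_def)
  then show ?thesis
    by (rule is_isoI)
qed

section \<open>Idempotents and corner rings\<close>

text \<open>For an idempotent \<open>e\<close> of a commutative ring \<open>R\<close>, the corner ring \<open>e R\<close>; it has the
  operations of \<open>R\<close> and the unit element \<open>e\<close>.\<close>

definition corner :: "('a, 'm) ring_scheme \<Rightarrow> 'a \<Rightarrow> ('a, 'm) ring_scheme" where
  "corner R e = R\<lparr>carrier := {x \<in> carrier R. e \<otimes>\<^bsub>R\<^esub> x = x}, one := e\<rparr>"

lemma corner_simps [simp]:
  "carrier (corner R e) = {x \<in> carrier R. e \<otimes>\<^bsub>R\<^esub> x = x}"
  "\<zero>\<^bsub>corner R e\<^esub> = \<zero>\<^bsub>R\<^esub>" "\<one>\<^bsub>corner R e\<^esub> = e"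
  "(\<oplus>\<^bsub>corner R e\<^esub>) = (\<oplus>\<^bsub>R\<^esub>)" "(\<otimes>\<^bsub>corner R e\<^esub>) = (\<otimes>\<^bsub>R\<^esub>)"
  by (simp_all add: corner_def)

lemma corner_add_pow [simp]: "add_pow (corner R e) (n::nat) x = add_pow R n x"
  by (simp add: add_pow_def nat_pow_def)

text \<open>Idempotent elements of the multiplicative monoid of a ring.\<close>

definition idempotent_elem :: "('a, 'm) ring_scheme \<Rightarrow> 'a \<Rightarrow> bool" where
  "idempotent_elem R e \<longleftrightarrow> e \<in> carrier R \<and> e \<otimes>\<^bsub>R\<^esub> e = e"

text \<open>The primitive idempotents are the minimal non-zero ones, for the order in which \<open>f\<close> lies
  below \<open>e\<close> if \<open>e \<otimes> f = f\<close>.\<close>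

definition primitive_idempotents :: "('a, 'm) ring_scheme \<Rightarrow> 'a set" where
  "primitive_idempotents R = {e. idempotent_elem R e \<and> e \<noteq> \<zero>\<^bsub>R\<^esub> \<and>
     (\<forall>f. idempotent_elem R f \<and> e \<otimes>\<^bsub>R\<^esub> f = f \<longrightarrow> f = \<zero>\<^bsub>R\<^esub> \<or> f = e)}"

lemma primitive_idempotentsD:
  assumes "e \<in> primitive_idempotents R"
  shows "e \<in> carrier R" "e \<otimes>\<^bsub>R\<^esub> e = e" "e \<noteq> \<zero>\<^bsub>R\<^esub>" "idempotent_elem R e"
    "\<And>f. idempotent_elem R f \<Longrightarrow> e \<otimes>\<^bsub>R\<^esub> f = f \<Longrightarrow> f = \<zero>\<^bsub>R\<^esub> \<or> f = e"
  using assms by (auto simp: primitive_idempotents_def idempotent_elem_def)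

context cring
begin

lemma corner_cring:
  assumes "idempotent_elem R e"
  shows "cring (corner R e)"
proof -
  have e: "e \<in> carrier R" "e \<otimes> e = e"
    using assms by (auto simp: idempotent_elem_def)
  show ?thesis
  proof (rule cringI)
    show "abelian_group (corner R e)"
    proof (rule abelian_groupI)
      fix x assume "x \<in> carrier (corner R e)"
      then have "\<ominus> x \<in> carrier (corner R e)" "\<ominus> x \<oplus> x = \<zero>"
        using e by (auto simp: r_minus l_neg)
      then show "\<exists>y\<in>carrier (corner R e). y \<oplus>\<^bsub>corner R e\<^esub> x = \<zero>\<^bsub>corner R e\<^esub>"
        by auto
    qed (use e in \<open>auto simp: r_distr a_ac\<close>)
    show "Group.comm_monoid (corner R e)"
      by (rule comm_monoidI) (use e in \<open>auto simp: m_assoc[symmetric] intro: m_comm\<close>)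
  qed (auto simp: l_distr)
qed

lemma corner_pow:
  assumes "idempotent_elem R e" "x \<in> carrier (corner R e)" "0 < (n::nat)"
  shows "x [^]\<^bsub>corner R e\<^esub> n = x [^] n"
proof -
  interpret C: cring "corner R e"
    using assms(1) by (rule corner_cring)
  have "x [^]\<^bsub>corner R e\<^esub> Suc k = x [^] Suc k" for k :: nat
  proof (induction k)
    case 0
    then show ?case
      using assms(2) by simp
  next
    case (Suc k)
    then show ?case
      by (subst C.nat_pow_Suc, subst nat_pow_Suc) simp
  qed
  then show ?thesis
    using gr0_implies_Suc[OF assms(3)] by metis
qed

lemma corner_reduced:
  assumes "idempotent_elem R e" "reduced_ring R"
  shows "reduced_ring (corner R e)"
  using assms corner_cring[OF assms(1)] corner_pow[OF assms(1)]
  unfolding reduced_ring_def by (auto simp: cring_def)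

text \<open>The characteristic of a corner \<open>e R\<close> is the additive order of \<open>e\<close>.\<close>

lemma corner_ring_char_dvd_iff:
  assumes "idempotent_elem R e"
  shows "ring_char (corner R e) dvd n \<longleftrightarrow> e \<otimes> add_pow R n \<one> = \<zero>"
proof -
  interpret C: cring "corner R e"
    using assms by (rule corner_cring)
  have e: "e \<in> carrier R"
    using assms by (auto simp: idempotent_elem_def)
  have "e \<otimes> add_pow R n \<one> = add_pow R n e"
    using add_pow_rdistr[OF e one_closed, of n] e by simp
  then show ?thesis
    using C.add_pow_one_eq_zero_iff[of n] by simp
qed

lemma idempotent_elem_mult:
  assumes "idempotent_elem R e" "idempotent_elem R f"
  shows "idempotent_elem R (e \<otimes> f)"
proof -
  have "(e \<otimes> f) \<otimes> (e \<otimes> f) = (e \<otimes> e) \<otimes> (f \<otimes> f)"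
    using assms unfolding idempotent_elem_def by (metis m_assoc m_lcomm m_closed)
  then show ?thesis
    using assms by (simp add: idempotent_elem_def)
qed

lemma primitive_idempotents_orthogonal:
  assumes "e \<in> primitive_idempotents R" "f \<in> primitive_idempotents R" "e \<noteq> f"
  shows "e \<otimes> f = \<zero>"
proof (rule ccontr)
  note e = primitive_idempotentsD[OF assms(1)] and f = primitive_idempotentsD[OF assms(2)]
  assume "e \<otimes> f \<noteq> \<zero>"
  moreover have "e \<otimes> (e \<otimes> f) = e \<otimes> f" "f \<otimes> (e \<otimes> f) = e \<otimes> f"
    using e(1,2) f(1,2) by (simp add: m_assoc[symmetric], metis m_lcomm)
  ultimately have "e \<otimes> f = e" "e \<otimes> f = f"
    using e(5) f(5) idempotent_elem_mult[OF e(4) f(4)] by metis+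
  with assms(3) show False
    by simp
qed

text \<open>Passing from an idempotent to a smaller one shrinks the corner, so in a finite ring the
  descent stops.\<close>

lemma exists_primitive_idempotent_below:
  assumes "finite (carrier R)" "idempotent_elem R g" "g \<noteq> \<zero>"
  shows "\<exists>e\<in>primitive_idempotents R. g \<otimes> e = e"
  using assms(2,3)
proof (induction g rule: measure_induct_rule[where f = "\<lambda>g. card (carrier (corner R g))"])
  case (less g)
  show ?case
  proof (cases "g \<in> primitive_idempotents R")
    case True
    then show ?thesis
      using less.prems by (auto simp: idempotent_elem_def)
  next
    case False
    then obtain f where f: "idempotent_elem R f" "g \<otimes> f = f" "f \<noteq> \<zero>" "f \<noteq> g"
      using less.prems unfolding primitive_idempotents_def by auto
    have car: "g \<in> carrier R" "f \<in> carrier R"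
      using less.prems f by (auto simp: idempotent_elem_def)
    have below: "g \<otimes> x = x" if "x \<in> carrier R" "f \<otimes> x = x" for x
      using that f(2) car m_assoc[of g f x] by simp
    have "f \<otimes> g \<noteq> g"
      using f car m_comm[of f g] by auto
    then have "carrier (corner R f) \<subset> carrier (corner R g)"
      using less.prems below by (auto simp: idempotent_elem_def)
    then have "card (carrier (corner R f)) < card (carrier (corner R g))"
      using assms(1) by (intro psubset_card_mono) auto
    then obtain e where e: "e \<in> primitive_idempotents R" "f \<otimes> e = e"
      using less.IH[OF _ f(1,3)] by auto
    then have "g \<otimes> e = e"
      using below primitive_idempotentsD(1)[OF e(1)] by simp
    with e(1) show ?thesis ..
  qed
qed

lemma finite_primitive_idempotents:
  assumes "finite (carrier R)"
  shows "finite (primitive_idempotents R)"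
  by (rule finite_subset[OF _ assms]) (auto dest: primitive_idempotentsD)

text \<open>By orthogonality, multiplication by a primitive idempotent extracts the component of a sum
  of corner elements.\<close>

lemma finsum_primitive_mult:
  assumes "finite (carrier R)" "f \<in> primitive_idempotents R"
    and v: "\<And>e. e \<in> primitive_idempotents R \<Longrightarrow> v e \<in> carrier (corner R e)"
  shows "f \<otimes> (\<Oplus>e\<in>primitive_idempotents R. v e) = v f"
proof -
  let ?E = "primitive_idempotents R"
  have vc: "v \<in> ?E \<rightarrow> carrier R"
    using v by auto
  have prod: "f \<otimes> v e = (if f = e then v e else \<zero>)" if "e \<in> ?E" for e
  proof (cases "f = e")
    case True
    then show ?thesis
      using v[OF that] by simp
  next
    case False
    have "f \<otimes> v e = (f \<otimes> e) \<otimes> v e"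
      using v[OF that] primitive_idempotentsD(1)[OF that] primitive_idempotentsD(1)[OF assms(2)]
      by (simp add: m_assoc)
    then show ?thesis
      using False primitive_idempotents_orthogonal[OF assms(2) that] v[OF that] by simp
  qed
  have "f \<otimes> (\<Oplus>e\<in>?E. v e) = (\<Oplus>e\<in>?E. f \<otimes> v e)"
    using finsum_rdistr[OF finite_primitive_idempotents[OF assms(1)] _ vc]
      primitive_idempotentsD(1)[OF assms(2)] by simp
  also have "\<dots> = (\<Oplus>e\<in>?E. if f = e then v e else \<zero>)"
    using prod vc by (intro finsum_cong') auto
  also have "\<dots> = v f"
    using assms(2) finite_primitive_idempotents[OF assms(1)] vc by (rule add.finprod_singleton)
  finally show ?thesis .
qed

text \<open>Otherwise \<open>\<one> \<ominus> s\<close>, with \<open>s\<close> the sum, would be a non-zero idempotent; but a primitive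
  idempotent below it would be orthogonal to \<open>s\<close>, in which it is a summand.\<close>

lemma finsum_primitive_idempotents:
  assumes "finite (carrier R)"
  shows "(\<Oplus>e\<in>primitive_idempotents R. e) = \<one>"
proof (rule ccontr)
  let ?E = "primitive_idempotents R"
  define s where "s = (\<Oplus>e\<in>?E. e)"
  have s: "s \<in> carrier R"
    unfolding s_def by (rule finsum_closed) (auto dest: primitive_idempotentsD)
  have mult_s: "f \<otimes> s = f" if "f \<in> ?E" for f
    unfolding s_def
    by (rule finsum_primitive_mult[OF assms that]) (auto dest: primitive_idempotentsD)
  have "s \<otimes> s = (\<Oplus>e\<in>?E. e \<otimes> s)"
    using s finsum_ldistr[OF finite_primitive_idempotents[OF assms] s, of "\<lambda>e. e"]
    unfolding s_def by (auto dest: primitive_idempotentsD)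
  also have "\<dots> = s"
    unfolding s_def[symmetric] by (subst (2) s_def, rule finsum_cong')
      (auto simp: mult_s dest: primitive_idempotentsD)
  finally have ss: "s \<otimes> s = s" .
  assume "(\<Oplus>e\<in>?E. e) \<noteq> \<one>"
  then have "\<one> \<ominus> s \<noteq> \<zero>"
    using s by (auto simp: s_def)
  moreover have "(\<one> \<ominus> s) \<otimes> (\<one> \<ominus> s) = \<one> \<ominus> s \<ominus> s \<oplus> s \<otimes> s"
    using s by algebra
  then have "(\<one> \<ominus> s) \<otimes> (\<one> \<ominus> s) = \<one> \<ominus> s"
    unfolding ss using s by algebra
  then have "idempotent_elem R (\<one> \<ominus> s)"
    using s by (simp add: idempotent_elem_def)
  ultimately obtain e where e: "e \<in> ?E" "(\<one> \<ominus> s) \<otimes> e = e"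
    using exists_primitive_idempotent_below[OF assms] by blast
  have ec: "e \<in> carrier R"
    using e(1) by (rule primitive_idempotentsD)
  have "(\<one> \<ominus> s) \<otimes> e = e \<ominus> e \<otimes> s"
    using s ec by algebra
  then have "e = \<zero>"
    using e(2) mult_s[OF e(1)] ec by (simp add: r_neg minus_eq)
  then show False
    using primitive_idempotentsD(3)[OF e(1)] by simp
qed

lemma decompose_by_primitive_idempotents:
  assumes "finite (carrier R)" "x \<in> carrier R"
  shows "(\<Oplus>e\<in>primitive_idempotents R. e \<otimes> x) = x"
proof -
  have "(\<lambda>e. e) \<in> primitive_idempotents R \<rightarrow> carrier R"
    by (auto dest: primitive_idempotentsD)
  then have "(\<Oplus>e\<in>primitive_idempotents R. e \<otimes> x) = (\<Oplus>e\<in>primitive_idempotents R. e) \<otimes> x"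
    using finsum_ldistr[OF finite_primitive_idempotents[OF assms(1)] assms(2)] by simp
  then show ?thesis
    using assms finsum_primitive_idempotents by simp
qed

lemma eq_by_primitive_idempotents:
  assumes "finite (carrier R)" "x \<in> carrier R" "y \<in> carrier R"
    and "\<And>e. e \<in> primitive_idempotents R \<Longrightarrow> e \<otimes> x = e \<otimes> y"
  shows "x = y"
proof -
  have "(\<Oplus>e\<in>primitive_idempotents R. e \<otimes> x) = (\<Oplus>e\<in>primitive_idempotents R. e \<otimes> y)"
    by (rule finsum_cong') (use assms in \<open>auto dest: primitive_idempotentsD\<close>)
  then show ?thesis
    using assms decompose_by_primitive_idempotents by metis
qed

lemma Units_corner:
  assumes "idempotent_elem R e" "u \<in> Units R"
  shows "e \<otimes> u \<in> Units (corner R e)"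
proof -
  have e: "e \<in> carrier R" "e \<otimes> e = e"
    using assms by (auto simp: idempotent_elem_def)
  have u: "u \<in> carrier R" "inv u \<in> carrier R" "u \<otimes> inv u = \<one>"
    using assms by auto
  have closed: "e \<otimes> x \<in> carrier (corner R e)" if "x \<in> carrier R" for x
    using e that by (simp add: m_assoc[symmetric])
  have "(e \<otimes> u) \<otimes> (e \<otimes> inv u) = (e \<otimes> e) \<otimes> (u \<otimes> inv u)"
    using e(1) u(1,2) by (simp add: m_ac)
  then have "(e \<otimes> u) \<otimes> (e \<otimes> inv u) = e"
    using e u by simp
  moreover have "(e \<otimes> inv u) \<otimes> (e \<otimes> u) = (e \<otimes> u) \<otimes> (e \<otimes> inv u)"
    using e u(1,2) by (intro m_comm) auto
  ultimately show ?thesis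
    using closed u unfolding Units_def by auto
qed

text \<open>The decomposition of the unit group: a unit \<open>u\<close> corresponds to the family of its
  components \<open>e \<otimes> u\<close>, and a family \<open>v\<close> of units of the corners to the sum of its members.\<close>

lemma units_of_iso_product_corners:
  assumes fin: "finite (carrier R)"
    and bij: "bij_betw e I (primitive_idempotents R)"
  shows "units_of R \<cong> product_group I (\<lambda>i. units_of (corner R (e i)))"
proof -
  let ?E = "primitive_idempotents R"
  have e: "e i \<in> ?E" if "i \<in> I" for i
    using bij that by (auto simp: bij_betw_def)
  have idem: "idempotent_elem R (e i)" and ec: "e i \<in> carrier R" if "i \<in> I" for i
    using primitive_idempotentsD[OF e[OF that]] by auto
  define h where "h = (\<lambda>u. \<lambda>i\<in>I. e i \<otimes> u)"
  have h_closed: "h u \<in> (\<Pi>\<^sub>E i\<in>I. Units (corner R (e i)))" if "u \<in> Units R" for u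
    using that idem by (auto simp: h_def Units_corner)
  have h_mult: "h (u \<otimes> v) = (\<lambda>i\<in>I. h u i \<otimes> h v i)" if "u \<in> Units R" "v \<in> Units R" for u v
  proof -
    have "e i \<otimes> (u \<otimes> v) = e i \<otimes> u \<otimes> (e i \<otimes> v)" if "i \<in> I" for i
    proof -
      have uv: "u \<in> carrier R" "v \<in> carrier R"
        using \<open>u \<in> Units R\<close> \<open>v \<in> Units R\<close> by auto
      have "e i \<otimes> u \<otimes> (e i \<otimes> v) = (e i \<otimes> e i) \<otimes> (u \<otimes> v)"
        using uv ec[OF that] by (simp add: m_ac)
      then show ?thesis
        using primitive_idempotentsD(2)[OF e[OF that]] by simp
    qed
    then show ?thesis
      by (auto simp: h_def fun_eq_iff)
  qed
  have h_inj: "inj_on h (Units R)"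
  proof (rule inj_onI)
    fix u v assume u: "u \<in> Units R" and v: "v \<in> Units R" and eq: "h u = h v"
    show "u = v"
    proof (rule eq_by_primitive_idempotents[OF fin])
      fix f assume "f \<in> ?E"
      then obtain i where "i \<in> I" "f = e i"
        using bij by (auto simp: bij_betw_def)
      then show "f \<otimes> u = f \<otimes> v"
        using fun_cong[OF eq, of i] by (simp add: h_def)
    qed (use u v in auto)
  qed
  have h_surj: "w \<in> h ` Units R" if w: "w \<in> (\<Pi>\<^sub>E i\<in>I. Units (corner R (e i)))" for w
  proof -
    define k where "k = inv_into I e"
    have k: "k f \<in> I" "e (k f) = f" if "f \<in> ?E" for f
      using bij that unfolding k_def bij_betw_def
      by (auto simp: inv_into_into f_inv_into_f)
    have ke: "k (e i) = i" if "i \<in> I" for i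
      using bij that unfolding k_def bij_betw_def by simp
    have wU: "w (k f) \<in> Units (corner R f)" if "f \<in> ?E" for f
      using w k[OF that] PiE_mem[OF w k(1)[OF that]] by simp
    have "\<forall>f\<in>?E. \<exists>y. y \<in> carrier (corner R f) \<and> w (k f) \<otimes> y = f"
      using wU unfolding Units_def by auto
    then obtain y where y: "\<And>f. f \<in> ?E \<Longrightarrow> y f \<in> carrier (corner R f)"
        "\<And>f. f \<in> ?E \<Longrightarrow> w (k f) \<otimes> y f = f"
      by metis
    have wc: "w (k f) \<in> carrier (corner R f)" if "f \<in> ?E" for f
      using wU[OF that] unfolding Units_def by auto
    define u where "u = (\<Oplus>f\<in>?E. w (k f))"
    define u' where "u' = (\<Oplus>f\<in>?E. y f)"
    have uc: "u \<in> carrier R" "u' \<in> carrier R"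
      unfolding u_def u'_def using wc y by (auto intro!: finsum_closed)
    have fu: "f \<otimes> u = w (k f)" "f \<otimes> u' = y f" if "f \<in> ?E" for f
      unfolding u_def u'_def using finsum_primitive_mult[OF fin that] wc y by auto
    have "u \<otimes> u' = \<one>"
    proof (rule eq_by_primitive_idempotents[OF fin])
      fix f assume f: "f \<in> ?E"
      have "f \<otimes> (u \<otimes> u') = (f \<otimes> f) \<otimes> (u \<otimes> u')"
        using primitive_idempotentsD[OF f] by simp
      also have "\<dots> = (f \<otimes> u) \<otimes> (f \<otimes> u')"
        using uc primitive_idempotentsD(1)[OF f] by (simp add: m_ac)
      also have "\<dots> = f"
        using fu[OF f] y(2)[OF f] by simp
      finally show "f \<otimes> (u \<otimes> u') = f \<otimes> \<one>"
        using primitive_idempotentsD(1)[OF f] by simp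
    qed (use uc in auto)
    then have "u \<in> Units R"
      using uc m_comm[OF uc] unfolding Units_def by auto
    moreover have "h u = w"
    proof
      fix i
      show "h u i = w i"
        using fu(1)[OF e, of i] ke[of i] PiE_arb[OF w, of i]
        by (cases "i \<in> I") (simp_all add: h_def)
    qed
    ultimately show ?thesis
      by auto
  qed
  have "h \<in> iso (units_of R) (product_group I (\<lambda>i. units_of (corner R (e i))))"
    using h_closed h_mult h_inj h_surj
    by (auto simp: iso_def hom_def bij_betw_def units_of_def)
  then show ?thesis
    by (rule is_isoI)
qed

end

section \<open>Rings whose elements are units or nilpotent\<close>

text \<open>The powers of \<open>x\<close> are eventually periodic; if \<open>a\<close> is an exponent in the periodic range
  and \<open>d\<close> a period, then the power with exponent \<open>a * d\<close> is idempotent.\<close>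

lemma (in monoid) exists_idempotent_power:
  assumes "finite (carrier G)" "x \<in> carrier G"
  shows "\<exists>n::nat. 0 < n \<and> x [^] n \<otimes> x [^] n = x [^] n"
proof -
  have "finite ((\<lambda>n::nat. x [^] Suc n) ` UNIV)"
    by (rule finite_subset[OF _ assms(1)]) (use assms(2) in \<open>auto simp del: nat_pow_Suc\<close>)
  then have "\<not> inj (\<lambda>n::nat. x [^] Suc n)"
    using finite_imageD infinite_UNIV_nat by blast
  then obtain i j :: nat where ij: "i < j" "x [^] Suc i = x [^] Suc j"
    unfolding inj_def by (metis linorder_neqE_nat)
  define a d where "a = Suc i" and "d = j - i"
  have a: "0 < a" and d: "0 < d" and period: "x [^] (a + d) = x [^] a"
    using ij by (auto simp: a_def d_def)
  have shift: "x [^] (a + k + t * d) = x [^] (a + k)" for k t :: nat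
  proof (induction t)
    case (Suc t)
    have "x [^] (a + k + Suc t * d) = x [^] (a + d) \<otimes> x [^] (k + t * d)"
      using assms(2) by (simp only: nat_pow_mult) (simp add: algebra_simps)
    also have "\<dots> = x [^] (a + k + t * d)"
      using assms(2) by (simp only: period nat_pow_mult) (simp add: algebra_simps)
    finally show ?case
      using Suc by simp
  qed simp
  have "a \<le> a * d"
    using d by simp
  then have "x [^] (a * d + a * d) = x [^] (a * d)"
    using shift[of "a * d - a" a] by simp
  then have "x [^] (a * d) \<otimes> x [^] (a * d) = x [^] (a * d)"
    using assms(2) by (simp add: nat_pow_mult)
  then show ?thesis
    using a d by (intro exI[of _ "a * d"]) simp
qed

text \<open>A commutative ring is called primary here if it is non-zero and each of its elements is a
  unit or nilpotent; this is the form in which locality of a finite ring is obtained.\<close>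

definition primary_ring :: "('a, 'm) ring_scheme \<Rightarrow> bool" where
  "primary_ring R \<longleftrightarrow> cring R \<and> \<one>\<^bsub>R\<^esub> \<noteq> \<zero>\<^bsub>R\<^esub> \<and>
    (\<forall>x\<in>carrier R. x \<in> Units R \<or> (\<exists>n::nat. x [^]\<^bsub>R\<^esub> n = \<zero>\<^bsub>R\<^esub>))"

lemma (in cring) primary_ringI:
  assumes "finite (carrier R)" "\<one> \<noteq> \<zero>"
    and "\<And>f. idempotent_elem R f \<Longrightarrow> f = \<zero> \<or> f = \<one>"
  shows "primary_ring R"
  unfolding primary_ring_def
proof (intro conjI ballI)
  fix x assume x: "x \<in> carrier R"
  obtain n :: nat where n: "0 < n" "x [^] n \<otimes> x [^] n = x [^] n"
    using exists_idempotent_power[OF assms(1) x] by auto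
  then have "x [^] n = \<zero> \<or> x [^] n = \<one>"
    using assms(3) x by (simp add: idempotent_elem_def)
  then show "x \<in> Units R \<or> (\<exists>n::nat. x [^] n = \<zero>)"
  proof
    assume "x [^] n = \<one>"
    then have "x [^] (n - 1) \<otimes> x = \<one>"
      using n(1) x nat_pow_Suc[of x "n - 1"] by simp
    then have "x \<in> Units R"
      using x m_comm[of x "x [^] (n - 1)"] unfolding Units_def by auto
    then show ?thesis ..
  qed auto
qed (use assms is_cring in auto)

lemma (in cring) primary_corner:
  assumes "finite (carrier R)" "e \<in> primitive_idempotents R"
  shows "primary_ring (corner R e)"
proof -
  note e = primitive_idempotentsD[OF assms(2)]
  interpret C: cring "corner R e"
    using e(4) by (rule corner_cring)
  show ?thesis
    by (rule C.primary_ringI) (use assms e in \<open>auto simp: idempotent_elem_def\<close>)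
qed

lemma primary_reduced_is_field:
  assumes "primary_ring R" "reduced_ring R"
  shows "field R"
proof -
  interpret cring R
    using assms(1) by (simp add: primary_ring_def)
  have one: "\<one>\<^bsub>R\<^esub> \<noteq> \<zero>\<^bsub>R\<^esub>"
    using assms(1) by (simp add: primary_ring_def)
  have "x \<in> Units R" if x: "x \<in> carrier R" "x \<noteq> \<zero>\<^bsub>R\<^esub>" for x
  proof (rule ccontr)
    assume "x \<notin> Units R"
    then obtain n :: nat where n: "x [^]\<^bsub>R\<^esub> n = \<zero>\<^bsub>R\<^esub>"
      using assms(1) x by (auto simp: primary_ring_def)
    moreover have "0 < n"
      using n one by (cases n) auto
    ultimately show False
      using assms(2) x by (auto simp: reduced_ring_def)
  qed
  moreover have "\<zero>\<^bsub>R\<^esub> \<notin> Units R"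
    using one by (auto simp: Units_def)
  ultimately have "Units R = carrier R - {\<zero>\<^bsub>R\<^esub>}"
    by auto
  then show ?thesis
    by (rule cring_fieldI)
qed

section \<open>Transport of rings along isomorphisms\<close>

lemma ring_iso_hom:
  assumes "f \<in> ring_iso R Q"
  shows "f \<in> ring_hom R Q" "bij_betw f (carrier R) (carrier Q)"
  using assms by (simp_all add: ring_iso_def)

lemma ring_hom_Units:
  assumes "ring R" "ring Q" "f \<in> ring_hom R Q" "u \<in> Units R"
  shows "f u \<in> Units Q"
proof -
  interpret R: ring R by fact
  have u: "u \<in> carrier R" "inv\<^bsub>R\<^esub> u \<in> carrier R"
    using assms(4) by auto
  have "f (u \<otimes>\<^bsub>R\<^esub> inv\<^bsub>R\<^esub> u) = \<one>\<^bsub>Q\<^esub>" "f (inv\<^bsub>R\<^esub> u \<otimes>\<^bsub>R\<^esub> u) = \<one>\<^bsub>Q\<^esub>"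
    using assms(3,4) by (simp_all add: ring_hom_one)
  then have "f u \<otimes>\<^bsub>Q\<^esub> f (inv\<^bsub>R\<^esub> u) = \<one>\<^bsub>Q\<^esub>" "f (inv\<^bsub>R\<^esub> u) \<otimes>\<^bsub>Q\<^esub> f u = \<one>\<^bsub>Q\<^esub>"
    using ring_hom_mult[OF assms(3)] u by simp_all
  then show ?thesis
    using ring_hom_closed[OF assms(3)] u unfolding Units_def by auto
qed

lemma ring_hom_nat_pow:
  assumes "ring R" "ring Q" "f \<in> ring_hom R Q" "x \<in> carrier R"
  shows "f (x [^]\<^bsub>R\<^esub> (n::nat)) = f x [^]\<^bsub>Q\<^esub> n"
proof -
  interpret ring_hom_ring R Q f
    using assms by (intro ring_hom_ringI2)
  show ?thesis
    using assms(4) by (rule hom_nat_pow)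
qed

lemma ring_iso_Units_iff:
  assumes "ring R" "ring Q" "f \<in> ring_iso R Q" "u \<in> carrier R"
  shows "f u \<in> Units Q \<longleftrightarrow> u \<in> Units R"
proof
  assume "f u \<in> Units Q"
  then have "inv_into (carrier R) f (f u) \<in> Units R"
    using ring_hom_Units[OF assms(2,1) ring_iso_hom(1)[OF ring_iso_set_sym[OF assms(1,3)]]] by blast
  then show "u \<in> Units R"
    using ring_iso_hom(2)[OF assms(3)] assms(4) by (simp add: bij_betw_def)
next
  show "f u \<in> Units Q" if "u \<in> Units R"
    using ring_hom_Units[OF assms(1,2) ring_iso_hom(1)[OF assms(3)] that] .
qed

lemma ring_iso_units_of:
  assumes "ring R" "ring Q" "f \<in> ring_iso R Q"
  shows "units_of R \<cong> units_of Q"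
proof -
  note f = ring_iso_hom[OF assms(3)]
  have UR: "Units R \<subseteq> carrier R" and UQ: "Units Q \<subseteq> carrier Q"
    by (auto simp: Units_def)
  have "f ` Units R = Units Q"
  proof
    show "f ` Units R \<subseteq> Units Q"
      using ring_hom_Units[OF assms(1,2) f(1)] by blast
    show "Units Q \<subseteq> f ` Units R"
    proof
      fix y assume y: "y \<in> Units Q"
      then obtain x where "x \<in> carrier R" "y = f x"
        using f(2) UQ by (auto simp: bij_betw_def)
      then show "y \<in> f ` Units R"
        using y ring_iso_Units_iff[OF assms] by auto
    qed
  qed
  then have "bij_betw f (Units R) (Units Q)"
    using f(2) UR by (auto simp: bij_betw_def intro: inj_on_subset)
  moreover have "f \<in> hom (units_of R) (units_of Q)"
    using ring_hom_Units[OF assms(1,2) f(1)] ring_hom_mult[OF f(1)] UR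
    by (intro homI) (auto simp: units_of_def subset_eq)
  ultimately show ?thesis
    by (intro is_isoI[of f]) (simp add: iso_def units_of_def)
qed

lemma ring_iso_zero:
  assumes "ring R" "ring Q" "f \<in> ring_iso R Q" "x \<in> carrier R"
  shows "f x = \<zero>\<^bsub>Q\<^esub> \<longleftrightarrow> x = \<zero>\<^bsub>R\<^esub>"
proof -
  have "f \<zero>\<^bsub>R\<^esub> = \<zero>\<^bsub>Q\<^esub>"
    using ring_iso_hom(1)[OF assms(3)] ring_hom_zero assms(1,2) by blast
  then show ?thesis
    using ring_iso_hom(2)[OF assms(3)] assms(4) ring.ring_simprules(2)[OF assms(1)]
    by (metis bij_betw_def inj_onD)
qed

lemma ring_iso_primary_ring:
  assumes "cring R" "cring Q" "f \<in> ring_iso R Q" "primary_ring R"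
  shows "primary_ring Q"
  unfolding primary_ring_def
proof (intro conjI ballI)
  interpret R: cring R by fact
  interpret Q: cring Q by fact
  note f = ring_iso_hom[OF assms(3)]
  have R: "\<one>\<^bsub>R\<^esub> \<noteq> \<zero>\<^bsub>R\<^esub>"
    "\<And>x. x \<in> carrier R \<Longrightarrow> x \<in> Units R \<or> (\<exists>n::nat. x [^]\<^bsub>R\<^esub> n = \<zero>\<^bsub>R\<^esub>)"
    using assms(4) by (auto simp: primary_ring_def)
  show "\<one>\<^bsub>Q\<^esub> \<noteq> \<zero>\<^bsub>Q\<^esub>"
    using ring_iso_zero[OF R.ring_axioms Q.ring_axioms assms(3) R.one_closed] R(1)
      ring_hom_one[OF f(1)] by simp
  fix y assume "y \<in> carrier Q"
  then obtain x where x: "x \<in> carrier R" "y = f x"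
    using f(2) by (auto simp: bij_betw_def)
  show "y \<in> Units Q \<or> (\<exists>n::nat. y [^]\<^bsub>Q\<^esub> n = \<zero>\<^bsub>Q\<^esub>)"
    using R(2)[OF x(1)]
  proof
    assume "\<exists>n::nat. x [^]\<^bsub>R\<^esub> n = \<zero>\<^bsub>R\<^esub>"
    then obtain n :: nat where "x [^]\<^bsub>R\<^esub> n = \<zero>\<^bsub>R\<^esub>" ..
    then have "y [^]\<^bsub>Q\<^esub> n = \<zero>\<^bsub>Q\<^esub>"
      using ring_hom_nat_pow[OF R.ring_axioms Q.ring_axioms f(1) x(1), of n] x
        ring_iso_zero[OF R.ring_axioms Q.ring_axioms assms(3) R.zero_closed] by simp
    then show ?thesis by blast
  qed (use x ring_hom_Units[OF R.ring_axioms Q.ring_axioms f(1)] in auto)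
qed (use assms(2) in auto)

lemma ring_iso_ring_char:
  assumes "ring R" "ring Q" "f \<in> ring_iso R Q"
  shows "ring_char Q = ring_char R"
proof -
  interpret R: ring R by fact
  interpret Q: ring Q by fact
  note f = ring_iso_hom(1)[OF assms(3)]
  interpret h: ring_hom_ring R Q f
    using f by (intro ring_hom_ringI2) (rule R.ring_axioms Q.ring_axioms)+
  have "f (add_pow R n \<one>\<^bsub>R\<^esub>) = add_pow Q n \<one>\<^bsub>Q\<^esub>" for n :: nat
  proof (induction n)
    case (Suc n)
    then show ?case
      by (simp add: R.add.nat_pow_Suc Q.add.nat_pow_Suc)
  qed simp
  then have "ring_char Q dvd n \<longleftrightarrow> ring_char R dvd n" for n
    using ring_iso_zero[OF assms, of "add_pow R n \<one>\<^bsub>R\<^esub>"]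
      R.add_pow_one_eq_zero_iff[of n] Q.add_pow_one_eq_zero_iff[of n] by simp
  then show ?thesis
    by (meson dvd_antisym dvd_refl)
qed

text \<open>Finite rings have isomorphic copies with carrier in \<^typ>\<open>nat\<close>.\<close>

lemma finite_cring_iso_nat:
  assumes "cring R" "finite (carrier R)"
  obtains Q :: "nat ring" and f where "cring Q" "finite (carrier Q)" "f \<in> ring_iso R Q"
proof -
  obtain f :: "'a \<Rightarrow> nat" where f: "inj_on f (carrier R)"
    using finite_imp_inj_to_nat_seg[OF assms(2)] by auto
  have "cring ((image_ring f R)\<lparr>zero := f \<zero>\<^bsub>R\<^esub>\<rparr>)"
    using cring.ring_iso_imp_img_cring[OF assms(1) inj_imp_image_ring_iso[OF f]] .
  then have "cring (image_ring f R)"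
    by (simp add: image_ring_def image_group_def monoid.defs)
  then show thesis
    by (rule that[OF _ _ inj_imp_image_ring_iso[OF f]])
       (simp add: image_ring_carrier assms(2))
qed

lemma finite_field_iso_nat:
  assumes "field R" "finite (carrier R)"
  obtains Q :: "nat ring" and f where "field Q" "finite (carrier Q)" "f \<in> ring_iso R Q"
proof -
  obtain f :: "'a \<Rightarrow> nat" where f: "inj_on f (carrier R)"
    using finite_imp_inj_to_nat_seg[OF assms(2)] by auto
  show thesis
    by (rule that[OF field.inj_imp_image_ring_is_field[OF assms(1) f] _ inj_imp_image_ring_iso[OF f]])
       (simp add: image_ring_carrier assms(2))
qed

section \<open>Finite local rings\<close>

lemma only_prime_divisor_imp_power:
  fixes p n :: nat
  assumes "Factorial_Ring.prime p" "0 < n"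
    and "\<And>q. Factorial_Ring.prime q \<Longrightarrow> q dvd n \<Longrightarrow> q = p"
  shows "\<exists>k. n = p ^ k"
proof -
  have "n \<noteq> 0" "\<not> is_unit p"
    using assms(1,2) not_prime_unit by auto
  then obtain m where m: "n = p ^ multiplicity p n * m" "\<not> p dvd m"
    using multiplicity_decompose' by blast
  have "m = 1"
  proof (rule ccontr)
    assume "m \<noteq> 1"
    then obtain q where "Factorial_Ring.prime q" "q dvd m"
      using prime_factor_nat by blast
    with m assms(3)[of q] show False
      by (metis dvd_mult)
  qed
  with m show ?thesis
    by auto
qed

text \<open>A prime divisor \<open>q\<close> of the order is the additive order of some element (Cauchy), hence
  divides the characteristic.\<close>

lemma (in ring) card_prime_power:
  assumes "finite (carrier R)" "Factorial_Ring.prime p" "ring_char R dvd p ^ e"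
  shows "\<exists>k. card (carrier R) = p ^ k"
proof (rule only_prime_divisor_imp_power[OF assms(2)])
  show "0 < card (carrier R)"
    using assms(1) by (auto simp: card_gt_0_iff)
  fix q :: nat assume q: "Factorial_Ring.prime q" "q dvd card (carrier R)"
  then obtain m where m: "order (add_monoid R) = q ^ 1 * m"
    by (auto simp: order_def)
  obtain H where H: "subgroup H (add_monoid R)" "card H = q"
    using sylow_thm[OF q(1) add.group_axioms m] assms(1) by auto
  have "finite H"
    using H q(1) by (auto intro: card_ge_0_finite simp: prime_gt_0_nat)
  have "\<not> H \<subseteq> {\<zero>}"
    using card_mono[of "{\<zero>}" H] H(2) prime_gt_1_nat[OF q(1)] by auto
  then obtain x where x: "x \<in> H" "x \<noteq> \<zero>"
    by auto
  have xc: "x \<in> carrier R"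
    using subgroup.mem_carrier[OF H(1) x(1)] by simp
  interpret H: group "(add_monoid R)\<lparr>carrier := H\<rparr>"
    using H(1) by (rule add.subgroup_imp_group)
  have "x [^]\<^bsub>(add_monoid R)\<lparr>carrier := H\<rparr>\<^esub> q = \<zero>"
    using H.pow_order_eq_1[of x] x H(2) by (simp add: order_def)
  then have "add_pow R q x = \<zero>"
    by (simp add: add_pow_def nat_pow_def)
  then have "add.ord x dvd q"
    using add.pow_eq_id[of x q] xc by simp
  moreover have "add.ord x \<noteq> 1"
    using add.ord_eq_1[of x] xc x(2) by simp
  ultimately have ord: "add.ord x = q"
    using q(1) by (auto simp: prime_nat_iff)
  have "add_pow R (p ^ e) x = \<zero>"
    using xc assms(3) by (rule add_pow_ring_char)
  then have "q dvd p ^ e"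
    using add.pow_eq_id[of x "p ^ e"] xc ord by simp
  then show "q = p"
    using q(1) assms(2) by (meson prime_dvd_power primes_dvd_imp_eq)
qed

text \<open>A surjection of a commutative group onto \<open>H\<close> splits when the orders of \<open>H\<close> and of the
  kernel are coprime: a suitable power map is a projection onto the kernel.\<close>

lemma coprime_extension_splits:
  fixes G (structure)
  assumes "group_hom G H f" "comm_group G"
    and surj: "f ` carrier G = carrier H"
    and finite: "finite (carrier H)" "finite (kernel G H f)"
    and coprime: "coprime (card (carrier H)) (card (kernel G H f))"
  shows "G \<cong> H \<times>\<times> G\<lparr>carrier := kernel G H f\<rparr>"
proof -
  interpret comm_group G by fact
  interpret f: group_hom G H f by fact
  let ?N = "card (carrier H)" and ?K = "kernel G H f"
  let ?M = "card ?K"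
  have K: "subgroup ?K G"
    by (rule f.subgroup_kernel)
  interpret K: group "G\<lparr>carrier := ?K\<rparr>"
    using K by (rule subgroup_imp_group)
  have pow_M: "x [^] ?M = \<one>" if "x \<in> ?K" for x
    using K.pow_order_eq_1[of x] that by (simp add: order_def nat_pow_def)
  have pow_N: "y [^]\<^bsub>H\<^esub> ?N = \<one>\<^bsub>H\<^esub>" if "y \<in> carrier H" for y
    using f.H.pow_order_eq_1[of y] that by (simp add: order_def)
  have M: "x [^] k = x [^] l" if "x \<in> ?K" "k mod ?M = l mod ?M" for x and k l :: nat
    using nat_pow_mod[OF _ pow_M[OF that(1)]] that subgroup.mem_carrier[OF K that(1)]
    by metis
  have N: "y [^]\<^bsub>H\<^esub> k = y [^]\<^bsub>H\<^esub> l" if "y \<in> carrier H" "k mod ?N = l mod ?N" for y and k l :: nat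
    using f.H.nat_pow_mod[OF _ pow_N[OF that(1)]] that by metis
  have "?N \<noteq> 0" "?M \<noteq> 0"
    using finite f.H.one_closed K.one_closed by auto
  then obtain c d c' d' :: nat where bezout: "?N * c = ?M * d + 1" "?M * c' = ?N * d' + 1"
    using bezout_nat[of ?N ?M] bezout_nat[of ?M ?N] coprime by (metis coprime_iff_gcd_eq_1 gcd.commute)
  \<comment> \<open>The map \<open>u \<mapsto> u [^] a\<close> is trivial modulo the kernel and the identity on the kernel; for
    \<open>u \<mapsto> u [^] b\<close> the roles are exchanged.\<close>
  define a b where "a = ?N * c" and "b = ?M * c'"
  have a: "a mod ?M = 1 mod ?M" "a mod ?N = 0 mod ?N"
    by (simp only: a_def bezout(1) mod_mult_self4) (simp add: a_def)
  have b: "b mod ?M = 0 mod ?M" "b mod ?N = 1 mod ?N"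
    by (simp add: b_def) (simp only: b_def bezout(2) mod_mult_self4)
  have pow_a: "u [^] a \<in> ?K" if "u \<in> carrier G" for u
    using that N[OF f.hom_closed[OF that] a(2)] by (simp add: kernel_def f.hom_nat_pow)
  let ?F = "\<lambda>u. (f u, u [^] a)"
  have "?F \<in> hom G (H \<times>\<times> G\<lparr>carrier := ?K\<rparr>)"
    using pow_a by (intro homI) (auto simp: pow_mult_distrib m_comm)
  moreover have "inj_on ?F (carrier G)"
  proof (rule inj_onI)
    fix u v assume u: "u \<in> carrier G" and v: "v \<in> carrier G" and eq: "?F u = ?F v"
    let ?w = "u \<otimes> inv v"
    have w: "?w \<in> ?K"
      using u v eq by (simp add: kernel_def)
    have "?w = ?w [^] a"
      using M[OF w a(1)] u v by simp
    also have "\<dots> = \<one>"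
      using u v eq by (simp add: pow_mult_distrib m_comm nat_pow_inv)
    finally show "u = v"
      using u v by (metis inv_closed inv_equality inv_inv)
  qed
  moreover have "(y, x) \<in> ?F ` carrier G" if y: "y \<in> carrier H" and x: "x \<in> ?K" for y x
  proof -
    have "y \<in> f ` carrier G"
      using surj y by simp
    then obtain u where u: "u \<in> carrier G" "f u = y"
      by auto
    have xc: "x \<in> carrier G" and fx: "f x = \<one>\<^bsub>H\<^esub>"
      using x by (auto simp: kernel_def)
    have "f (u [^] b) = y"
      using N[OF y b(2)] u y by (simp add: f.hom_nat_pow)
    then have 1: "f (u [^] b \<otimes> x) = y"
      using u xc fx y by simp
    have "(u [^] b) [^] a = (u [^] a) [^] b"
      using u by (simp add: nat_pow_pow mult.commute)
    also have "\<dots> = \<one>"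
      using M[OF pow_a[OF u(1)] b(1)] by simp
    finally have "(u [^] b \<otimes> x) [^] a = x"
      using u xc M[OF x a(1)] by (simp add: pow_mult_distrib m_comm)
    with 1 have "(y, x) = ?F (u [^] b \<otimes> x)"
      by simp
    then show ?thesis
      by (rule image_eqI) (use u xc in simp)
  qed
  ultimately have "?F \<in> iso G (H \<times>\<times> G\<lparr>carrier := ?K\<rparr>)"
    using pow_a by (auto simp: iso_def bij_betw_def)
  then show ?thesis
    by (rule is_isoI)
qed

context cring
begin

text \<open>If \<open>x\<close> and \<open>\<one> \<ominus> x\<close> were both nilpotent, then \<open>\<one> \<ominus> x\<close> would fix the last non-zero power
  of \<open>x\<close>, and so would its powers, one of which is zero.\<close>

lemma primary_unit_or_one_minus_unit:
  assumes "primary_ring R" "x \<in> carrier R"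
  shows "x \<in> Units R \<or> \<one> \<ominus> x \<in> Units R"
proof (rule ccontr)
  assume "\<not> (x \<in> Units R \<or> \<one> \<ominus> x \<in> Units R)"
  then have nonunit: "x \<notin> Units R" "\<one> \<ominus> x \<notin> Units R"
    by auto
  have one: "\<one> \<noteq> \<zero>"
    using assms(1) by (simp add: primary_ring_def)
  have nil: "\<exists>n::nat. y [^] n = \<zero>" if "y \<in> carrier R" "y \<notin> Units R" for y
    using assms(1) that by (auto simp: primary_ring_def)
  obtain j :: nat where j: "(\<one> \<ominus> x) [^] j = \<zero>"
    using nil[OF _ nonunit(2)] assms(2) by auto
  define a where "a = (LEAST n::nat. x [^] n = \<zero>)"
  have a: "x [^] a = \<zero>"
    unfolding a_def using nil[OF assms(2) nonunit(1)] by (rule LeastI_ex)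
  then obtain k where k: "a = Suc k"
    using one by (cases a) auto
  let ?z = "x [^] k"
  have "?z \<noteq> \<zero>"
    using not_less_Least[of k "\<lambda>n. x [^] n = \<zero>"] k unfolding a_def by simp
  have z: "?z \<in> carrier R" "x \<otimes> ?z = \<zero>"
    using assms(2) a k by (simp_all add: m_comm)
  have "(\<one> \<ominus> x) \<otimes> ?z = ?z \<ominus> x \<otimes> ?z"
    using assms(2) z(1) by algebra
  then have fix_z: "(\<one> \<ominus> x) \<otimes> ?z = ?z"
    using z by (simp add: minus_eq)
  have "(\<one> \<ominus> x) [^] n \<otimes> ?z = ?z" for n :: nat
    using assms(2) z(1) fix_z by (induction n) (simp_all add: m_assoc)
  from this[of j] show False
    using j z(1) \<open>?z \<noteq> \<zero>\<close> by simp
qed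

lemma Units_of_mult_left:
  assumes "a \<in> carrier R" "b \<in> carrier R" "a \<otimes> b \<in> Units R"
  shows "b \<in> Units R"
proof -
  let ?c = "inv (a \<otimes> b)"
  have "?c \<in> carrier R" "?c \<otimes> (a \<otimes> b) = \<one>"
    using assms(3) by simp_all
  then have "(?c \<otimes> a) \<otimes> b = \<one>" "?c \<otimes> a \<in> carrier R"
    using assms by (simp_all add: m_assoc)
  then show ?thesis
    using assms(2) m_comm[of b "?c \<otimes> a"] unfolding Units_def by auto
qed

lemma ideal_nonunits:
  assumes "primary_ring R"
  shows "ideal (carrier R - Units R) R"
proof (rule idealI)
  show "ring R"
    by (rule ring_axioms)
  have one: "\<one> \<noteq> \<zero>"
    using assms by (simp add: primary_ring_def)
  have zero: "\<zero> \<notin> Units R"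
    using one unfolding Units_def by auto
  have mult: "x \<otimes> a \<in> carrier R - Units R" if "a \<in> carrier R - Units R" "x \<in> carrier R" for a x
    using that Units_of_mult_left by blast
  then show mult': "\<And>a x. a \<in> carrier R - Units R \<Longrightarrow> x \<in> carrier R \<Longrightarrow> x \<otimes> a \<in> carrier R - Units R" .
  show "\<And>a x. a \<in> carrier R - Units R \<Longrightarrow> x \<in> carrier R \<Longrightarrow> a \<otimes> x \<in> carrier R - Units R"
    using mult m_comm by simp
  show "subgroup (carrier R - Units R) (add_monoid R)"
  proof (rule add.subgroupI)
    show "carrier R - Units R \<noteq> {}"
      using zero by auto
    fix a assume a: "a \<in> carrier R - Units R"
    then show "\<ominus> a \<in> carrier R - Units R"
      using mult[OF a, of "\<ominus> \<one>"] by (simp add: l_minus)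
  next
    fix x y assume x: "x \<in> carrier R - Units R" and y: "y \<in> carrier R - Units R"
    show "x \<oplus> y \<in> carrier R - Units R"
    proof (rule ccontr)
      assume "x \<oplus> y \<notin> carrier R - Units R"
      then have u: "x \<oplus> y \<in> Units R"
        using x y by auto
      let ?v = "inv (x \<oplus> y)"
      have v: "?v \<in> carrier R" "?v \<otimes> (x \<oplus> y) = \<one>"
        using u by auto
      have "\<one> \<ominus> ?v \<otimes> x = ?v \<otimes> y"
      proof -
        have "x \<in> carrier R" "y \<in> carrier R"
          using x y by auto
        then have "?v \<otimes> (x \<oplus> y) \<ominus> ?v \<otimes> x = ?v \<otimes> y"
          using v(1) by algebra
        then show ?thesis
          using v(2) by simp
      qed
      then show False
        using primary_unit_or_one_minus_unit[OF assms, of "?v \<otimes> x"] mult[OF x v(1)] mult[OF y v(1)]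
        by simp
    qed
  qed auto
qed

lemma ideal_without_units:
  assumes "ideal J R" "u \<in> J" "u \<in> Units R"
  shows "J = carrier R"
proof -
  have "inv u \<otimes> u \<in> J"
    using assms by (intro ideal.I_l_closed) auto
  then show ?thesis
    using assms(3) by (intro ideal.one_imp_carrier[OF assms(1)]) simp
qed

lemma local_ring_nonunits:
  assumes "primary_ring R"
  shows "local_ring R (carrier R - Units R)"
  unfolding local_ring_def
proof (intro conjI allI impI)
  let ?m = "carrier R - Units R"
  note m = ideal_nonunits[OF assms]
  show "maximalideal ?m R"
  proof (rule maximalidealI[OF m])
    show "carrier R \<noteq> ?m"
      using Units_one_closed by auto
    fix J assume "ideal J R" "?m \<subseteq> J" "J \<subseteq> carrier R"
    then show "J = ?m \<or> J = carrier R"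
      using ideal_without_units[of J] by blast
  qed
  fix J assume J: "maximalideal J R"
  then interpret J: maximalideal J R .
  have "J \<subseteq> ?m"
    using ideal_without_units[OF J.is_ideal] J.I_notcarr J.Icarr by blast
  then show "J = ?m"
    using J.I_maximal[OF m] Units_one_closed by auto
qed (rule is_cring)

text \<open>A prime divisor \<open>p\<close> of the characteristic gives a zero divisor \<open>p \<cdot> \<one>\<close>, which therefore
  is nilpotent.\<close>

lemma primary_ring_char:
  assumes "finite (carrier R)" "primary_ring R"
  obtains p e where "Factorial_Ring.prime p" "0 < e" "ring_char R = p ^ e"
proof -
  let ?c = "ring_char R"
  have one: "\<one> \<noteq> \<zero>"
    using assms(2) by (simp add: primary_ring_def)
  have c: "0 < ?c" "?c \<noteq> 1"
    using ring_char_pos[OF assms(1)] add_pow_one_eq_zero_iff[of 1] one by auto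
  then obtain p where p: "Factorial_Ring.prime p" "p dvd ?c"
    using prime_factor_nat by blast
  then obtain d where d: "?c = p * d"
    by auto
  let ?p = "add_pow R p \<one>" and ?d = "add_pow R d \<one>"
  have "\<not> ?c dvd d"
    using d c(1) prime_gt_1_nat[OF p(1)] by (auto dest!: dvd_imp_le)
  then have d0: "?d \<noteq> \<zero>"
    using add_pow_one_eq_zero_iff[of d] by simp
  have mult: "add_pow R (m * n) \<one> = add_pow R m \<one> \<otimes> add_pow R n \<one>" for m n :: nat
  proof -
    have "add_pow R (m * n) \<one> = add_pow R m (add_pow R n \<one>)"
      using add.nat_pow_pow[OF one_closed, of m n] by (simp add: mult.commute)
    also have "\<dots> = add_pow R m \<one> \<otimes> add_pow R n \<one>"
      by (rule add_pow_eq_mult_one) simp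
    finally show ?thesis .
  qed
  have "?p \<otimes> ?d = \<zero>"
    using mult[of p d] d add_pow_one_eq_zero_iff[of ?c] by simp
  then have "?p \<notin> Units R"
    using d0 Units_l_cancel[of ?p ?d \<zero>] by auto
  then obtain k :: nat where k: "?p [^] k = \<zero>"
    using assms(2) by (auto simp: primary_ring_def)
  have "add_pow R (p ^ n) \<one> = ?p [^] n" for n
    by (induction n) (simp_all add: mult m_comm)
  then have "?c dvd p ^ k"
    using k add_pow_one_eq_zero_iff[of "p ^ k"] by simp
  then obtain e where e: "?c = p ^ e"
    using divides_primepow_nat[OF p(1)] by auto
  moreover have "0 < e"
    using e c(2) by (cases e) auto
  ultimately show thesis
    using that p(1) by blast
qed

end

text \<open>The data attached to a finite local ring \<open>C\<close> in the description of its unit group: the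
  prime \<open>p\<close>, the degree \<open>l\<close> of the residue field \<open>K\<close>, and a local ring \<open>B\<close> with maximal ideal
  \<open>\<mm>\<close>, which will be a copy of \<open>C\<close>; of this only the equality of the characteristics is recorded.
  The carriers of \<open>K\<close> and \<open>B\<close> are sets of natural numbers.\<close>

definition local_factor ::
    "('a, 'm) ring_scheme \<Rightarrow> nat \<Rightarrow> nat \<Rightarrow> nat ring \<Rightarrow> nat ring \<Rightarrow> nat set \<Rightarrow> bool" where
  "local_factor C p l K B \<mm> \<longleftrightarrow>
     Factorial_Ring.prime p \<and> 1 \<le> l \<and> field K \<and> finite (carrier K) \<and> card (carrier K) = p ^ l \<and>
     finite (carrier B) \<and> local_ring B \<mm> \<and>
     (\<exists>e>0. ring_char B = p ^ e \<and> ring_char C = p ^ e) \<and>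
     B Quot \<mm> \<simeq> K \<and> comm_group (one_plus_group B \<mm>) \<and>
     (\<exists>e. order (one_plus_group B \<mm>) = p ^ e) \<and>
     units_of C \<cong> units_of K \<times>\<times> one_plus_group B \<mm>"

text \<open>The reduction \<open>B\<^sup>* \<rightarrow> (B/\<mm>)\<^sup>*\<close> is surjective with kernel \<open>1 + \<mm>\<close>. The
  order of the kernel is a power of \<open>p\<close>, that of the image is \<open>p ^ l - 1\<close>, so the extension splits.\<close>

lemma (in cring) finite_local_units:
  fixes \<mm> p e
  defines "\<mm> \<equiv> carrier R - Units R"
  assumes fin: "finite (carrier R)" and primary: "primary_ring R"
    and p: "Factorial_Ring.prime p" "ring_char R = p ^ e"
  obtains K :: "nat ring" and l where "field K" "finite (carrier K)" "card (carrier K) = p ^ l"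
    "1 \<le> l" "R Quot \<mm> \<simeq> K" "comm_group (one_plus_group R \<mm>)"
    "\<exists>k. order (one_plus_group R \<mm>) = p ^ k"
    "units_of R \<cong> units_of K \<times>\<times> one_plus_group R \<mm>"
proof -
  have maximal: "maximalideal \<mm> R"
    using local_ring_nonunits[OF primary] by (simp add: local_ring_def \<mm>_def)
  interpret m: maximalideal \<mm> R
    by (rule maximal)
  have field_Q: "field (R Quot \<mm>)"
    using is_cring by (rule m.quotient_is_field)
  have carrier_Q: "carrier (R Quot \<mm>) = (+>) \<mm> ` carrier R"
    by (auto simp: FactRing_def A_RCOSETS_def')
  have "finite (carrier (R Quot \<mm>))"
    using fin by (simp add: carrier_Q)
  then obtain K :: "nat ring" and f where K: "field K" "finite (carrier K)" and f: "f \<in> ring_iso (R Quot \<mm>) K"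
    using finite_field_iso_nat[OF field_Q] by blast
  interpret K: field K
    by (rule K(1))
  interpret Q: field "R Quot \<mm>"
    by (rule field_Q)
  define g where "g = f \<circ> (+>) \<mm>"
  have g: "g \<in> ring_hom R K"
    unfolding g_def using m.rcos_ring_hom ring_iso_hom(1)[OF f] by (rule ring_hom_trans)
  have g_surj: "g ` carrier R = carrier K"
    using ring_iso_hom(2)[OF f] by (simp add: g_def carrier_Q bij_betw_def image_image)
  have g_zero: "g x = \<zero>\<^bsub>K\<^esub> \<longleftrightarrow> x \<in> \<mm>" if x: "x \<in> carrier R" for x
  proof -
    have "g x = \<zero>\<^bsub>K\<^esub> \<longleftrightarrow> \<mm> +> x = \<zero>\<^bsub>R Quot \<mm>\<^esub>"
      using ring_iso_zero[OF Q.ring_axioms K.ring_axioms f, of "\<mm> +> x"] x by (simp add: g_def carrier_Q)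
    also have "\<dots> \<longleftrightarrow> \<mm> +> x = \<mm>"
      by (simp add: FactRing_def)
    also have "\<dots> \<longleftrightarrow> x \<in> \<mm>"
      using m.a_rcos_const[of x] m.a_rcos_self[OF x] by auto
    finally show ?thesis .
  qed
  interpret g: ring_hom_ring R K g
    using g by (intro ring_hom_ringI2) (rule ring_axioms K.ring_axioms)+
  have g_Units: "g x \<in> Units K \<longleftrightarrow> x \<in> Units R" if x: "x \<in> carrier R" for x
    using g_zero[OF x] x g.hom_closed[OF x] by (auto simp: K.field_Units \<mm>_def)

  obtain N where N: "card (carrier R) = p ^ N"
    using card_prime_power[OF fin p(1), of e] p(2) by auto
  have lagrange: "card (carrier K) * card \<mm> = p ^ N"
    using a_lagrange[OF fin m.additive_subgroup_axioms] N
      bij_betw_same_card[OF ring_iso_hom(2)[OF f]] by (simp add: order_def FactRing_def)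
  obtain l where l: "card (carrier K) = p ^ l"
    using lagrange divides_primepow_nat[OF p(1)] by (metis dvd_triv_left)
  obtain k where k: "card \<mm> = p ^ k"
    using lagrange divides_primepow_nat[OF p(1)] by (metis dvd_triv_right)
  have "card {\<zero>\<^bsub>K\<^esub>, \<one>\<^bsub>K\<^esub>} \<le> card (carrier K)"
    using K(2) by (intro card_mono) auto
  then have "1 \<le> l"
    using l by (cases l) auto

  interpret U: comm_group "units_of R"
    by (rule units_comm_group)
  have hom: "group_hom (units_of R) (units_of K) g"
    using g_Units
    by (intro group_hom.intro group_hom_axioms.intro U.group_axioms K.units_group homI)
       (auto simp: units_of_def Units_closed)
  have kernel: "kernel (units_of R) (units_of K) g = \<one> <+ \<mm>"
  proof (intro equalityI subsetI)
    fix u assume "u \<in> kernel (units_of R) (units_of K) g"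
    then have u: "u \<in> Units R" "u \<in> carrier R" "g u = \<one>\<^bsub>K\<^esub>"
      by (auto simp: kernel_def units_of_def)
    then have "g (u \<ominus> \<one>) = \<zero>\<^bsub>K\<^esub>"
      by (simp add: minus_eq K.r_neg)
    then have "u \<ominus> \<one> \<in> \<mm>"
      using g_zero u by simp
    moreover have "u = \<one> \<oplus> (u \<ominus> \<one>)"
      using u by algebra
    ultimately show "u \<in> \<one> <+ \<mm>"
      unfolding a_l_coset_def' by blast
  next
    fix u assume "u \<in> \<one> <+ \<mm>"
    then obtain x where x: "x \<in> \<mm>" "u = \<one> \<oplus> x"
      by (auto simp: a_l_coset_def')
    then have "g u = \<one>\<^bsub>K\<^esub>" "u \<in> carrier R"
      using g_zero m.Icarr by auto
    moreover from this have "u \<in> Units R"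
      using g_Units[of u] by simp
    ultimately show "u \<in> kernel (units_of R) (units_of K) g"
      by (simp add: kernel_def units_of_def)
  qed
  have "g ` Units R = Units K"
  proof
    show "g ` Units R \<subseteq> Units K"
      using g_Units by auto
    show "Units K \<subseteq> g ` Units R"
    proof
      fix y assume y: "y \<in> Units K"
      then have "y \<in> g ` carrier R"
        by (simp add: g_surj K.Units_closed)
      then show "y \<in> g ` Units R"
        using y g_Units by auto
    qed
  qed
  then have surj: "g ` carrier (units_of R) = carrier (units_of K)"
    by (simp add: units_of_def)
  have plus: "one_plus_group R \<mm> = units_of R\<lparr>carrier := kernel (units_of R) (units_of K) g\<rparr>"
    by (simp add: one_plus_group_def kernel)
  have card_kernel: "card (kernel (units_of R) (units_of K) g) = p ^ k"
  proof -
    have "\<one> <+ \<mm> = (\<lambda>x. \<one> \<oplus> x) ` \<mm>"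
      by (auto simp: a_l_coset_def')
    moreover have "inj_on (\<lambda>x. \<one> \<oplus> x) \<mm>"
      by (rule inj_onI) (simp add: m.Icarr)
    ultimately show ?thesis
      using k by (simp add: kernel card_image)
  qed
  have finite_kernel: "finite (kernel (units_of R) (units_of K) g)"
    by (rule finite_subset[OF _ fin]) (auto simp: kernel_def units_of_def)
  have "card (carrier (units_of K)) = p ^ l - 1"
    using K(2) l by (simp add: units_of_def K.field_Units)
  moreover have "coprime (p ^ l - 1) (p ^ k)"
  proof -
    have "coprime (p ^ l - 1) (p ^ l)"
      using p(1) by (intro coprime_diff_one_left_nat) (simp add: prime_gt_0_nat)
    then show ?thesis
      using \<open>1 \<le> l\<close> by simp
  qed
  ultimately have "coprime (card (carrier (units_of K))) (card (kernel (units_of R) (units_of K) g))"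
    by (simp add: card_kernel)
  then have iso: "units_of R \<cong> units_of K \<times>\<times> one_plus_group R \<mm>"
    unfolding plus using K(2)
    by (intro coprime_extension_splits[OF hom U.comm_group_axioms surj _ finite_kernel])
       (auto simp: units_of_def K.finite_ring_finite_units)
  have subgroup: "subgroup (kernel (units_of R) (units_of K) g) (units_of R)"
    by (rule group_hom.subgroup_kernel[OF hom])
  have "comm_group (one_plus_group R \<mm>)"
    unfolding plus
    by (rule group.group_comm_groupI[OF U.subgroup_imp_group[OF subgroup]])
       (use subgroup.mem_carrier[OF subgroup] U.m_comm in auto)
  moreover have "order (one_plus_group R \<mm>) = p ^ k"
    by (simp add: plus order_def card_kernel)
  moreover have "R Quot \<mm> \<simeq> K"
    using f by (auto simp: is_ring_iso_def)
  ultimately show thesis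
    using that K l \<open>1 \<le> l\<close> iso by blast
qed

lemma exists_local_factor:
  assumes "finite (carrier C)" "primary_ring C"
  shows "\<exists>p l K B \<mm>. local_factor C p l K B \<mm>"
proof -
  interpret C: cring C
    using assms(2) by (simp add: primary_ring_def)
  obtain p e where p: "Factorial_Ring.prime p" "0 < e" "ring_char C = p ^ e"
    using C.primary_ring_char[OF assms] .
  obtain B :: "nat ring" and f where B: "cring B" "finite (carrier B)" and f: "f \<in> ring_iso C B"
    using finite_cring_iso_nat[OF C.is_cring assms(1)] .
  interpret B: cring B
    by (rule B(1))
  have primary: "primary_ring B"
    using ring_iso_primary_ring[OF C.is_cring B(1) f assms(2)] .
  have char: "ring_char B = p ^ e"
    using ring_iso_ring_char[OF C.ring_axioms B.ring_axioms f] p(3) by simp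
  let ?m = "carrier B - Units B"
  obtain K :: "nat ring" and l where K: "field K" "finite (carrier K)" "card (carrier K) = p ^ l"
    "1 \<le> l" "B Quot ?m \<simeq> K" "comm_group (one_plus_group B ?m)"
    "\<exists>k. order (one_plus_group B ?m) = p ^ k"
    "units_of B \<cong> units_of K \<times>\<times> one_plus_group B ?m"
    using B.finite_local_units[OF B(2) primary p(1) char] .
  have "units_of C \<cong> units_of K \<times>\<times> one_plus_group B ?m"
    using ring_iso_units_of[OF C.ring_axioms B.ring_axioms f] K(8) by (rule iso_trans)
  then have "local_factor C p l K B ?m"
    unfolding local_factor_def
    using K B(2) p char B.local_ring_nonunits[OF primary] by blast
  then show ?thesis
    by blast
qed

section \<open>Unit groups of finite commutative rings\<close>

text \<open>The unit group of \<open>R\<close> is a finite product of groups \<open>K\<^sup>* \<times> (1 + \<mm>)\<close>, each one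
  attached to a finite local ring \<open>B\<close> with maximal ideal \<open>\<mm>\<close> and residue field \<open>K\<close> of
  characteristic dividing that of \<open>R\<close>, and every prime divisor of the characteristic of \<open>R\<close>
  occurs.\<close>

definition units_decompose :: "('a, 'm) ring_scheme \<Rightarrow> bool" where
  "units_decompose R \<longleftrightarrow>
    (\<exists>(n::nat) (p :: nat \<Rightarrow> nat) (l :: nat \<Rightarrow> nat) (K :: nat \<Rightarrow> nat ring)
        (B :: nat \<Rightarrow> nat ring) (\<mm> :: nat \<Rightarrow> nat set).
      (\<forall>i<n. Factorial_Ring.prime (p i) \<and> p i dvd ring_char R \<and> 1 \<le> l i \<and>
         field (K i) \<and> finite (carrier (K i)) \<and> card (carrier (K i)) = p i ^ l i \<and>
         finite (carrier (B i)) \<and> local_ring (B i) (\<mm> i) \<and>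
         (\<exists>e. ring_char (B i) = p i ^ e) \<and>
         B i Quot \<mm> i \<simeq> K i \<and>
         comm_group (one_plus_group (B i) (\<mm> i)) \<and>
         (\<exists>e. order (one_plus_group (B i) (\<mm> i)) = p i ^ e)) \<and>
      (\<forall>q. Factorial_Ring.prime q \<and> q dvd ring_char R \<longrightarrow> (\<exists>i<n. p i = q)) \<and>
      units_of R \<cong>
        product_group {..<n} (\<lambda>i. units_of (K i) \<times>\<times> one_plus_group (B i) (\<mm> i)))"

text \<open>A prime divisor \<open>q\<close> of the characteristic \<open>c\<close> occurs because \<open>(c / q) \<cdot> \<one>\<close> is non-zero, so
  some component of it is non-zero, and this component is killed by \<open>q\<close>.\<close>

lemma (in cring) finite_units_decompose:
  assumes fin: "finite (carrier R)"
  shows "units_decompose R"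
proof -
  let ?E = "primitive_idempotents R"
  define n where "n = card ?E"
  obtain e where e: "bij_betw e {..<n} ?E"
    using ex_bij_betw_nat_finite[OF finite_primitive_idempotents[OF fin]]
    by (auto simp: n_def atLeast0LessThan)
  have eE: "e i \<in> ?E" if "i < n" for i
    using e that by (auto simp: bij_betw_def)
  have idem: "idempotent_elem R (e i)" if "i < n" for i
    using primitive_idempotentsD(4)[OF eE[OF that]] .
  have "\<forall>i. \<exists>p l K B \<mm>. i < n \<longrightarrow> local_factor (corner R (e i)) p l K B \<mm>"
    using exists_local_factor[OF _ primary_corner[OF fin eE]] fin by (auto intro: finite_subset)
  then obtain p l K B \<mm> where
    factor: "\<And>i. i < n \<Longrightarrow> local_factor (corner R (e i)) (p i) (l i) (K i) (B i) (\<mm> i)"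
    by metis
  have char_dvd: "ring_char (corner R (e i)) dvd ring_char R" if "i < n" for i
    using corner_ring_char_dvd_iff[OF idem[OF that], of "ring_char R"]
      add_pow_one_eq_zero_iff[of "ring_char R"] primitive_idempotentsD(1)[OF eE[OF that]] by simp
  have char: "\<exists>k>0. ring_char (corner R (e i)) = p i ^ k" and prime: "Factorial_Ring.prime (p i)"
    if "i < n" for i
    using factor[OF that] by (auto simp: local_factor_def)
  have "p i dvd ring_char R" if "i < n" for i
    using char[OF that] char_dvd[OF that] by (metis dvd_power dvd_trans)
  then have "\<forall>i<n. Factorial_Ring.prime (p i) \<and> p i dvd ring_char R \<and> 1 \<le> l i \<and>
      field (K i) \<and> finite (carrier (K i)) \<and> card (carrier (K i)) = p i ^ l i \<and>
      finite (carrier (B i)) \<and> local_ring (B i) (\<mm> i) \<and>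
      (\<exists>e. ring_char (B i) = p i ^ e) \<and>
      B i Quot \<mm> i \<simeq> K i \<and>
      comm_group (one_plus_group (B i) (\<mm> i)) \<and>
      (\<exists>e. order (one_plus_group (B i) (\<mm> i)) = p i ^ e)"
    using factor unfolding local_factor_def by blast
  moreover have "\<exists>i<n. p i = q" if q: "Factorial_Ring.prime q" "q dvd ring_char R" for q
  proof -
    obtain d where d: "ring_char R = q * d"
      using q(2) by auto
    have "\<not> ring_char R dvd d"
      using d ring_char_pos[OF fin] prime_gt_1_nat[OF q(1)] by (auto dest!: dvd_imp_le)
    then have "add_pow R d \<one> \<noteq> \<zero>"
      using add_pow_one_eq_zero_iff[of d] by simp
    then obtain f where f: "f \<in> ?E" "f \<otimes> add_pow R d \<one> \<noteq> \<zero>"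
      using eq_by_primitive_idempotents[OF fin, of "add_pow R d \<one>" \<zero>] primitive_idempotentsD(1)
      by fastforce
    then have "f \<in> e ` {..<n}"
      using e by (simp add: bij_betw_def)
    with f(2) obtain i where i: "i < n" "e i \<otimes> add_pow R d \<one> \<noteq> \<zero>"
      by auto
    obtain k where k: "ring_char (corner R (e i)) = p i ^ k"
      using char[OF i(1)] by auto
    have "\<not> p i ^ k dvd d" "p i ^ k dvd q * d"
      using i corner_ring_char_dvd_iff[OF idem[OF i(1)], of d] char_dvd[OF i(1)] k d by simp_all
    then have "\<not> coprime (p i ^ k) q"
      using coprime_dvd_mult_right_iff by blast
    then have "\<not> coprime (p i) q"
      by auto
    then have "p i = q"
      using primes_coprime[OF prime[OF i(1)] q(1)] by auto
    with i(1) show ?thesis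
      by blast
  qed
  moreover have "units_of R \<cong> product_group {..<n} (\<lambda>i. units_of (K i) \<times>\<times> one_plus_group (B i) (\<mm> i))"
  proof -
    have "product_group {..<n} (\<lambda>i. units_of (corner R (e i))) \<cong>
        product_group {..<n} (\<lambda>i. units_of (K i) \<times>\<times> one_plus_group (B i) (\<mm> i))"
      by (rule product_group_cong_iso) (use factor in \<open>auto simp: local_factor_def\<close>)
    then show ?thesis
      using units_of_iso_product_corners[OF fin e] iso_trans by blast
  qed
  ultimately show ?thesis
    unfolding units_decompose_def by blast
qed

lemma (in cring) finite_reduced_units:
  assumes fin: "finite (carrier R)" and reduced: "reduced_ring R"
  shows "product_of_finite_field_unit_groups (units_of R)"
proof -
  let ?E = "primitive_idempotents R"
  define n where "n = card ?E"
  obtain e where e: "bij_betw e {..<n} ?E"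
    using ex_bij_betw_nat_finite[OF finite_primitive_idempotents[OF fin]]
    by (auto simp: n_def atLeast0LessThan)
  have "\<exists>K :: nat ring. field K \<and> finite (carrier K) \<and> units_of (corner R (e i)) \<cong> units_of K"
    if i: "i < n" for i
  proof -
    have eE: "e i \<in> ?E"
      using e i by (auto simp: bij_betw_def)
    have C: "field (corner R (e i))"
      by (rule primary_reduced_is_field[OF primary_corner[OF fin eE]
        corner_reduced[OF primitive_idempotentsD(4)[OF eE] reduced]])
    interpret C: field "corner R (e i)"
      by (rule C)
    obtain K :: "nat ring" and f where "field K" "finite (carrier K)" "f \<in> ring_iso (corner R (e i)) K"
      using finite_field_iso_nat[OF C] fin by auto
    then show ?thesis
      using ring_iso_units_of[OF C.ring_axioms] by (meson field.is_ring)
  qed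
  then obtain K :: "nat \<Rightarrow> nat ring" where K: "\<And>i. i < n \<Longrightarrow> field (K i)"
    "\<And>i. i < n \<Longrightarrow> finite (carrier (K i))" "\<And>i. i < n \<Longrightarrow> units_of (corner R (e i)) \<cong> units_of (K i)"
    by metis
  have "product_group {..<n} (\<lambda>i. units_of (corner R (e i))) \<cong>
      product_group {..<n} (\<lambda>i. units_of (K i))"
    by (rule product_group_cong_iso) (use K in auto)
  then have "units_of R \<cong> product_group {..<n} (\<lambda>i. units_of (K i))"
    using units_of_iso_product_corners[OF fin e] iso_trans by blast
  then show ?thesis
    using K unfolding product_of_finite_field_unit_groups_def by blast
qed

section \<open>Products of fields\<close>

text \<open>The direct product of a family of rings; its multiplicative monoid is
  \<^const>\<open>product_group\<close>.\<close>

definition product_ring :: "'i set \<Rightarrow> ('i \<Rightarrow> ('a, 'm) ring_scheme) \<Rightarrow> ('i \<Rightarrow> 'a) ring" where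
  "product_ring I K =
    \<lparr>carrier = (\<Pi>\<^sub>E i\<in>I. carrier (K i)), monoid.mult = (\<lambda>x y. \<lambda>i\<in>I. x i \<otimes>\<^bsub>K i\<^esub> y i),
     one = (\<lambda>i\<in>I. \<one>\<^bsub>K i\<^esub>), ring.zero = (\<lambda>i\<in>I. \<zero>\<^bsub>K i\<^esub>), add = (\<lambda>x y. \<lambda>i\<in>I. x i \<oplus>\<^bsub>K i\<^esub> y i)\<rparr>"

lemma product_ring_simps [simp]:
  "carrier (product_ring I K) = (\<Pi>\<^sub>E i\<in>I. carrier (K i))"
  "x \<otimes>\<^bsub>product_ring I K\<^esub> y = (\<lambda>i\<in>I. x i \<otimes>\<^bsub>K i\<^esub> y i)"
  "x \<oplus>\<^bsub>product_ring I K\<^esub> y = (\<lambda>i\<in>I. x i \<oplus>\<^bsub>K i\<^esub> y i)"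
  "\<one>\<^bsub>product_ring I K\<^esub> = (\<lambda>i\<in>I. \<one>\<^bsub>K i\<^esub>)"
  "\<zero>\<^bsub>product_ring I K\<^esub> = (\<lambda>i\<in>I. \<zero>\<^bsub>K i\<^esub>)"
  by (simp_all add: product_ring_def)

lemma product_ring_cring:
  assumes "\<And>i. i \<in> I \<Longrightarrow> cring (K i)"
  shows "cring (product_ring I K)"
proof (rule cringI)
  have ring: "ring (K i)" if "i \<in> I" for i
    using assms[OF that] by (rule cring.axioms(1))
  note simps = ring.ring_simprules[OF ring] cring.cring_simprules[OF assms]
  show "abelian_group (product_ring I K)"
  proof (rule abelian_groupI)
    fix x assume x: "x \<in> carrier (product_ring I K)"
    let ?y = "\<lambda>i\<in>I. \<ominus>\<^bsub>K i\<^esub> x i"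
    have "?y \<in> carrier (product_ring I K)"
      using x by (auto simp: PiE_iff simps)
    moreover have "?y \<oplus>\<^bsub>product_ring I K\<^esub> x = \<zero>\<^bsub>product_ring I K\<^esub>"
      using x by (simp add: PiE_iff simps cong: restrict_cong)
    ultimately show "\<exists>y\<in>carrier (product_ring I K).
        y \<oplus>\<^bsub>product_ring I K\<^esub> x = \<zero>\<^bsub>product_ring I K\<^esub>"
      by blast
  next
    fix x assume x: "x \<in> carrier (product_ring I K)"
    show "\<zero>\<^bsub>product_ring I K\<^esub> \<oplus>\<^bsub>product_ring I K\<^esub> x = x"
      using x by (intro PiE_ext[of _ I "\<lambda>i. carrier (K i)"]) (auto simp: PiE_iff simps)
  next
    fix x y assume "x \<in> carrier (product_ring I K)" "y \<in> carrier (product_ring I K)"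
    then show "x \<oplus>\<^bsub>product_ring I K\<^esub> y = y \<oplus>\<^bsub>product_ring I K\<^esub> x"
      by (auto simp: PiE_iff intro!: restrict_ext abelian_monoid.a_comm[OF abelian_group.axioms(1)[OF ring.is_abelian_group[OF ring]]])
  qed (auto simp: PiE_iff simps intro!: restrict_ext)
  show "Group.comm_monoid (product_ring I K)"
  proof (rule comm_monoidI)
    fix x assume x: "x \<in> carrier (product_ring I K)"
    show "\<one>\<^bsub>product_ring I K\<^esub> \<otimes>\<^bsub>product_ring I K\<^esub> x = x"
      using x by (intro PiE_ext[of _ I "\<lambda>i. carrier (K i)"])
        (auto simp: PiE_iff monoid.l_one[OF ring.is_monoid[OF ring]])
  next
    fix x y assume "x \<in> carrier (product_ring I K)" "y \<in> carrier (product_ring I K)"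
    then show "x \<otimes>\<^bsub>product_ring I K\<^esub> y = y \<otimes>\<^bsub>product_ring I K\<^esub> x"
      by (auto simp: PiE_iff intro!: restrict_ext comm_monoid.m_comm[OF cring.axioms(2)[OF assms]])
  qed (auto simp: PiE_iff simps intro!: restrict_ext)
qed (auto simp: PiE_iff ring.ring_simprules cring.axioms(1)[OF assms] intro!: restrict_ext)

lemma product_ring_nat_pow:
  assumes "i \<in> I"
  shows "(x [^]\<^bsub>product_ring I K\<^esub> (n::nat)) i = x i [^]\<^bsub>K i\<^esub> n"
  using assms by (induction n) (simp_all add: nat_pow_def)

lemma product_ring_reduced:
  assumes "\<And>i. i \<in> I \<Longrightarrow> field (K i)"
  shows "reduced_ring (product_ring I K)"
proof -
  interpret P: cring "product_ring I K"
    using assms by (intro product_ring_cring) (simp add: fieldE(1))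
  have "x = \<zero>\<^bsub>product_ring I K\<^esub>"
    if x: "x \<in> carrier (product_ring I K)" "x [^]\<^bsub>product_ring I K\<^esub> n = \<zero>\<^bsub>product_ring I K\<^esub>"
    for x and n :: nat
  proof (rule PiE_ext)
    show "x \<in> (\<Pi>\<^sub>E i\<in>I. carrier (K i))" "\<zero>\<^bsub>product_ring I K\<^esub> \<in> (\<Pi>\<^sub>E i\<in>I. carrier (K i))"
      using x P.zero_closed by simp_all
    fix i assume i: "i \<in> I"
    interpret field "K i"
      using assms[OF i] .
    have "x i [^]\<^bsub>K i\<^esub> n = \<zero>\<^bsub>K i\<^esub>"
      using product_ring_nat_pow[OF i, of K x n] x(2) i by simp
    moreover have "x i \<in> carrier (K i)"
      using x(1) i by auto
    ultimately have "x i = \<zero>\<^bsub>K i\<^esub>"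
      by (induction n) (auto simp: integral_iff)
    then show "x i = \<zero>\<^bsub>product_ring I K\<^esub> i"
      using i by simp
  qed
  then show ?thesis
    using P.ring_axioms unfolding reduced_ring_def by blast
qed

lemma units_of_product_ring:
  assumes "\<And>i. i \<in> I \<Longrightarrow> ring (K i)"
  shows "units_of (product_ring I K) = product_group I (\<lambda>i. units_of (K i))"
proof -
  have "Units (product_ring I K) = (\<Pi>\<^sub>E i\<in>I. Units (K i))"
  proof
    show "Units (product_ring I K) \<subseteq> (\<Pi>\<^sub>E i\<in>I. Units (K i))"
    proof
      fix x assume "x \<in> Units (product_ring I K)"
      then obtain y where x: "x \<in> (\<Pi>\<^sub>E i\<in>I. carrier (K i))" and y: "y \<in> (\<Pi>\<^sub>E i\<in>I. carrier (K i))"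
        and yx: "(\<lambda>i\<in>I. y i \<otimes>\<^bsub>K i\<^esub> x i) = (\<lambda>i\<in>I. \<one>\<^bsub>K i\<^esub>)"
        and xy: "(\<lambda>i\<in>I. x i \<otimes>\<^bsub>K i\<^esub> y i) = (\<lambda>i\<in>I. \<one>\<^bsub>K i\<^esub>)"
        unfolding Units_def by auto
      have "x i \<in> Units (K i)" if i: "i \<in> I" for i
        using fun_cong[OF yx, of i] fun_cong[OF xy, of i] PiE_mem[OF x i] PiE_mem[OF y i] i
        unfolding Units_def by auto
      then show "x \<in> (\<Pi>\<^sub>E i\<in>I. Units (K i))"
        using x by (simp add: PiE_iff)
    qed
    show "(\<Pi>\<^sub>E i\<in>I. Units (K i)) \<subseteq> Units (product_ring I K)"
    proof
      fix x assume x: "x \<in> (\<Pi>\<^sub>E i\<in>I. Units (K i))"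
      let ?y = "\<lambda>i\<in>I. inv\<^bsub>K i\<^esub> x i"
      have m: "Group.monoid (K i)" if "i \<in> I" for i
        using assms[OF that] by (simp add: ring_def)
      have xi: "x i \<in> Units (K i)" if "i \<in> I" for i
        using x that by auto
      have "x \<in> carrier (product_ring I K)"
        using x xi by (auto simp: PiE_iff Units_def)
      moreover have "?y \<in> carrier (product_ring I K)"
        using m xi by (auto simp: monoid.Units_inv_closed)
      moreover have "?y \<otimes>\<^bsub>product_ring I K\<^esub> x = \<one>\<^bsub>product_ring I K\<^esub>"
        "x \<otimes>\<^bsub>product_ring I K\<^esub> ?y = \<one>\<^bsub>product_ring I K\<^esub>"
        using m xi by (auto simp: monoid.Units_l_inv monoid.Units_r_inv intro!: restrict_ext)
      ultimately show "x \<in> Units (product_ring I K)"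
        unfolding Units_def by blast
    qed
  qed
  then show ?thesis
    by (simp add: units_of_def product_group_def product_ring_def)
qed

lemma ring_iso_reduced:
  assumes "ring R" "ring Q" "f \<in> ring_iso R Q" "reduced_ring R"
  shows "reduced_ring Q"
  unfolding reduced_ring_def
proof (intro conjI ballI allI impI)
  fix y and n :: nat assume "y \<in> carrier Q" "0 < n" "y [^]\<^bsub>Q\<^esub> n = \<zero>\<^bsub>Q\<^esub>"
  note f = ring_iso_hom[OF assms(3)]
  interpret R: ring R by fact
  from \<open>y \<in> carrier Q\<close> obtain x where x: "x \<in> carrier R" "y = f x"
    using f(2) by (auto simp: bij_betw_def)
  have "f (x [^]\<^bsub>R\<^esub> n) = \<zero>\<^bsub>Q\<^esub>"
    using ring_hom_nat_pow[OF assms(1,2) f(1) x(1)] x(2) \<open>y [^]\<^bsub>Q\<^esub> n = \<zero>\<^bsub>Q\<^esub>\<close> by simp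
  then have "x [^]\<^bsub>R\<^esub> n = \<zero>\<^bsub>R\<^esub>"
    using ring_iso_zero[OF assms(1-3), of "x [^]\<^bsub>R\<^esub> n"] x(1) by simp
  then have "x = \<zero>\<^bsub>R\<^esub>"
    using assms(4) x(1) \<open>0 < n\<close> by (auto simp: reduced_ring_def)
  then show "y = \<zero>\<^bsub>Q\<^esub>"
    using ring_iso_zero[OF assms(1-3) x(1)] x(2) by simp
qed (rule assms(2))

lemma product_of_field_units_occurs:
  assumes "product_of_finite_field_unit_groups G"
  shows "occurs_as_units_of_reduced_ring TYPE(nat) G"
proof -
  obtain n and K :: "nat \<Rightarrow> nat ring" where K: "\<forall>i<n. field (K i) \<and> finite (carrier (K i))"
    and G: "G \<cong> product_group {..<n} (\<lambda>i. units_of (K i))"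
    using assms unfolding product_of_finite_field_unit_groups_def by blast
  let ?P = "product_ring {..<n} K"
  interpret P: cring ?P
    using K by (intro product_ring_cring) (auto intro: fieldE(1))
  have finite: "finite (carrier ?P)"
    using K by (auto intro: finite_PiE)
  obtain Q :: "nat ring" and f where Q: "cring Q" "finite (carrier Q)" and f: "f \<in> ring_iso ?P Q"
    using finite_cring_iso_nat[OF P.is_cring finite] .
  interpret Q: cring Q
    by (rule Q(1))
  have "reduced_ring Q"
    using K by (intro ring_iso_reduced[OF P.ring_axioms Q.ring_axioms f] product_ring_reduced) auto
  moreover have "units_of ?P = product_group {..<n} (\<lambda>i. units_of (K i))"
    using K by (intro units_of_product_ring) (auto intro: cring.axioms(1) fieldE(1))
  then have "G \<cong> units_of Q"
    using iso_trans[OF G] ring_iso_units_of[OF P.ring_axioms Q.ring_axioms f] by simp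
  ultimately show ?thesis
    using Q.ring_char_pos[OF Q(2)] unfolding occurs_as_units_of_reduced_ring_def by blast
qed

section \<open>Rings with finite abelian unit group\<close>

lemma (in ring) reduced_unit_span:
  assumes "reduced_ring R"
  shows "reduced_ring (unit_span R)"
proof -
  have "ring (unit_span R)"
    using subring_is_ring[OF subring_unit_span] by (simp add: unit_span_def)
  then show ?thesis
    using assms unit_span_subset unfolding reduced_ring_def by (auto dest: subsetD)
qed

lemma occurs_imp_product_of_field_units:
  assumes "occurs_as_units_of_reduced_ring TYPE('b) G" "comm_group G" "finite (carrier G)"
  shows "product_of_finite_field_unit_groups G"
proof -
  obtain R :: "'b ring" where R: "reduced_ring R" "0 < ring_char R" "G \<cong> units_of R"
    using assms(1) unfolding occurs_as_units_of_reduced_ring_def by blast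
  interpret R: ring R
    using R(1) by (simp add: reduced_ring_def)
  interpret G: comm_group G by fact
  have units: "comm_group (units_of R)"
    using G.iso_imp_comm_group[OF R(3)] R.units_group group.is_monoid by blast
  have "finite (Units R)"
    using iso_finite[OF R(3)] assms(3) by (simp add: units_of_def)
  then have finite: "finite (carrier (unit_span R))"
    using R(2) by (rule R.finite_unit_span)
  interpret S: cring "unit_span R"
    using units by (rule R.cring_unit_span)
  have "product_of_finite_field_unit_groups (units_of R)"
    using S.finite_reduced_units[OF finite R.reduced_unit_span[OF R(1)]]
    by (simp add: R.units_of_unit_span)
  then show ?thesis
    using iso_trans[OF R(3)] unfolding product_of_finite_field_unit_groups_def by blast
qed

text \<open>Without zero divisors the span of the units has no idempotents besides \<open>\<zero>\<close> and \<open>\<one>\<close> and no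
  non-zero nilpotents, so it is a field.\<close>

lemma (in ring) units_of_ring_without_zero_divisors:
  assumes "ring_without_zero_divisors R" "0 < ring_char R" "finite (Units R)"
    "comm_group (units_of R)"
  shows "\<exists>K :: nat ring. field K \<and> finite (carrier K) \<and> units_of R \<cong> units_of K"
proof -
  have finite: "finite (carrier (unit_span R))"
    using assms(3,2) by (rule finite_unit_span)
  interpret S: cring "unit_span R"
    using assms(4) by (rule cring_unit_span)
  have one: "\<one> \<noteq> \<zero>"
    using assms(1) by (simp add: ring_without_zero_divisors_def)
  have integral: "a = \<zero> \<or> b = \<zero>"
    if "a \<in> carrier (unit_span R)" "b \<in> carrier (unit_span R)" "a \<otimes> b = \<zero>" for a b
    using assms(1) that unit_span_subset unfolding ring_without_zero_divisors_def
    by (auto dest: subsetD)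
  have "f = \<zero> \<or> f = \<one>" if "idempotent_elem (unit_span R) f" for f
  proof -
    have f: "f \<in> carrier (unit_span R)" "f \<otimes> f = f"
      using that by (auto simp: idempotent_elem_def)
    then have fR: "f \<in> carrier R"
      using unit_span_subset by auto
    have "f \<oplus> \<ominus> \<one> \<in> carrier (unit_span R)"
      using subringE(7)[OF subring_unit_span f(1)] subringE(5)[OF subring_unit_span]
        subringE(3)[OF subring_unit_span] by blast
    moreover have "f \<otimes> (f \<oplus> \<ominus> \<one>) = \<zero>"
      using fR f(2) by (simp add: r_distr r_minus r_neg)
    ultimately have "f = \<zero> \<or> f \<oplus> \<ominus> \<one> = \<zero>"
      using integral[OF f(1)] by blast
    then show ?thesis
      using fR by (metis minus_equality minus_minus one_closed a_inv_closed)
  qed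
  then have primary: "primary_ring (unit_span R)"
    using finite one by (intro S.primary_ringI) auto
  have "x = \<zero>" if "x \<in> carrier (unit_span R)" "x [^] (n::nat) = \<zero>" for x n
    using that(2)
  proof (induction n)
    case 0
    then show ?case
      using one by simp
  next
    case (Suc n)
    have "x [^] n \<in> carrier (unit_span R)"
      using S.nat_pow_closed[OF that(1), of n] by simp
    then show ?case
      using Suc integral[OF _ that(1)] by auto
  qed
  then have "reduced_ring (unit_span R)"
    using S.ring_axioms unfolding reduced_ring_def by auto
  then have "field (unit_span R)"
    by (rule primary_reduced_is_field[OF primary])
  then obtain K :: "nat ring" and f where K: "field K" "finite (carrier K)"
    and f: "f \<in> ring_iso (unit_span R) K"
    using finite_field_iso_nat finite by blast
  interpret K: field K
    by (rule K(1))
  have "units_of R \<cong> units_of K"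
    using ring_iso_units_of[OF S.ring_axioms K.ring_axioms f] by (simp add: units_of_unit_span)
  with K show ?thesis
    by blast
qed

lemma (in ring) units_decompose:
  assumes "0 < ring_char R" "finite (Units R)" "comm_group (units_of R)"
  shows "units_decompose R"
proof -
  interpret S: cring "unit_span R"
    using assms(3) by (rule cring_unit_span)
  have "units_decompose (unit_span R)"
    using assms(2,1) by (intro S.finite_units_decompose finite_unit_span)
  then show ?thesis
    by (simp only: units_decompose_def unit_span_simps units_of_unit_span)
qed

theorem corollary3p2:
  fixes A :: "('a, 'm) ring_scheme" and G :: "('g, 'k) monoid_scheme"
  shows
    "(ring A \<and> 0 < ring_char A \<and> finite (Units A) \<and> comm_group (units_of A) \<longrightarrow>
       (\<exists>(n::nat) (p :: nat \<Rightarrow> nat) (l :: nat \<Rightarrow> nat) (K :: nat \<Rightarrow> nat ring)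
          (B :: nat \<Rightarrow> nat ring) (\<mm> :: nat \<Rightarrow> nat set).
          (\<forall>i<n. Factorial_Ring.prime (p i) \<and> p i dvd ring_char A \<and> 1 \<le> l i \<and>
             field (K i) \<and> finite (carrier (K i)) \<and> card (carrier (K i)) = p i ^ l i \<and>
             finite (carrier (B i)) \<and> local_ring (B i) (\<mm> i) \<and>
             (\<exists>e. ring_char (B i) = p i ^ e) \<and>
             B i Quot \<mm> i \<simeq> K i \<and>
             comm_group (one_plus_group (B i) (\<mm> i)) \<and>
             (\<exists>e. order (one_plus_group (B i) (\<mm> i)) = p i ^ e)) \<and>
          (\<forall>q. Factorial_Ring.prime q \<and> q dvd ring_char A \<longrightarrow> (\<exists>i<n. p i = q)) \<and>
          units_of A \<cong>
            product_group {..<n} (\<lambda>i. units_of (K i) \<times>\<times> one_plus_group (B i) (\<mm> i))))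
     \<and>
     (comm_group G \<and> finite (carrier G) \<longrightarrow>
       (occurs_as_units_of_reduced_ring TYPE(nat) G \<longleftrightarrow> product_of_finite_field_unit_groups G) \<and>
       (occurs_as_units_of_reduced_ring TYPE('b) G \<longrightarrow> product_of_finite_field_unit_groups G))
     \<and>
     (ring_without_zero_divisors A \<and> 0 < ring_char A \<and>
        finite (Units A) \<and> comm_group (units_of A) \<longrightarrow>
       (\<exists>K :: nat ring. field K \<and> finite (carrier K) \<and> units_of A \<cong> units_of K))"
proof (intro conjI impI)
  assume A: "ring A \<and> 0 < ring_char A \<and> finite (Units A) \<and> comm_group (units_of A)"
  then interpret ring A
    by simp
  show "\<exists>(n::nat) (p :: nat \<Rightarrow> nat) (l :: nat \<Rightarrow> nat) (K :: nat \<Rightarrow> nat ring)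
          (B :: nat \<Rightarrow> nat ring) (\<mm> :: nat \<Rightarrow> nat set).
          (\<forall>i<n. Factorial_Ring.prime (p i) \<and> p i dvd ring_char A \<and> 1 \<le> l i \<and>
             field (K i) \<and> finite (carrier (K i)) \<and> card (carrier (K i)) = p i ^ l i \<and>
             finite (carrier (B i)) \<and> local_ring (B i) (\<mm> i) \<and>
             (\<exists>e. ring_char (B i) = p i ^ e) \<and>
             B i Quot \<mm> i \<simeq> K i \<and>
             comm_group (one_plus_group (B i) (\<mm> i)) \<and>
             (\<exists>e. order (one_plus_group (B i) (\<mm> i)) = p i ^ e)) \<and>
          (\<forall>q. Factorial_Ring.prime q \<and> q dvd ring_char A \<longrightarrow> (\<exists>i<n. p i = q)) \<and>
          units_of A \<cong>
            product_group {..<n} (\<lambda>i. units_of (K i) \<times>\<times> one_plus_group (B i) (\<mm> i))"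
    using A units_decompose unfolding units_decompose_def by simp
next
  assume "comm_group G \<and> finite (carrier G)"
  then show "occurs_as_units_of_reduced_ring TYPE(nat) G \<longleftrightarrow> product_of_finite_field_unit_groups G"
    using occurs_imp_product_of_field_units product_of_field_units_occurs by blast
next
  assume "comm_group G \<and> finite (carrier G)" "occurs_as_units_of_reduced_ring TYPE('b) G"
  then show "product_of_finite_field_unit_groups G"
    using occurs_imp_product_of_field_units by blast
next
  assume A: "ring_without_zero_divisors A \<and> 0 < ring_char A \<and>
    finite (Units A) \<and> comm_group (units_of A)"
  then interpret ring A
    by (simp add: ring_without_zero_divisors_def)
  show "\<exists>K :: nat ring. field K \<and> finite (carrier K) \<and> units_of A \<cong> units_of K"
    using A by (intro units_of_ring_without_zero_divisors) simp_all
qed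

end
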